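(* The Lie algebras $\mathcal N_{r,s}$ and $\mathcal N_{s,r}$ are isomorphic for $(r,s)\in\{(5,2),(5,1),(6,2),(6,1)\}$.
   Context: $\mathbb R^{r,s}$ denotes $\mathbb R^{r+s}$ with the symmetric bilinear form $\langle x,y\rangle_{r,s}=\sum_{i=1}^r x_iy_i-\sum_{j=1}^s x_{r+j}y_{r+j}$, and $\mathrm{Cl}_{r,s}$ is the Clifford algebra it generates with the convention $x\otimes x=-\langle x,x\rangle_{r,s}$. A $\mathrm{Cl}_{r,s}$-module is a finite-dimensional real vector space $U$ with a linear map $J\colon\mathbb R^{r,s}\to\mathrm{End}(U)$ such that $J_z^2=-\langle z,z\rangle_{r,s}\mathrm{Id}_U$. It is admissible if equipped with a non-degenerate symmetric bilinear form $\langle\cdot,\cdot\rangle_U$ with $\langle J_zx,y\rangle_U+\langle x,J_zy\rangle_U=0$ for all $z,x,y$; minimal admissible (denoted $V^{r,s}$) means (nonzero) admissible of the smallest possible dimension. $\mathcal N_{r,s}(U)=U\oplus\mathbb R^{r,s}$ is the 2-step nilpotent Lie algebra with centre $\mathbb R^{r,s}$ and bracket $[U,U]\subset\mathbb R^{r,s}$ given by $\langle J_zx,y\rangle_U=\langle z,[x,y]\rangle_{r,s}$. One writes $\mathcal N_{r,s}=\mathcal N_{r,s}(V^{r,s})$; up to isomorphism this does not depend on the choice of the minimal admissible module. *)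

theory Defs
  imports "HOL-Analysis.Analysis" "HOL-Analysis.Finite_Function_Topology"
begin

text \<open>
  The dimensions are the cardinalities of the index types: for \<open>CARD('r) = r\<close> and
  \<open>CARD('s) = s\<close>, the space of pseudo-Euclidean vectors is \<open>real ^ ('r + 's)\<close>, the
  \<open>Inl\<close> coordinates being the positive ones and the \<open>Inr\<close> coordinates the negative ones.
\<close>

definition pseudo_inner :: "real ^ ('r::finite + 's::finite) \<Rightarrow> real ^ ('r + 's) \<Rightarrow> real"
  where "pseudo_inner x y =
    (\<Sum>i\<in>UNIV. x $ Inl i * y $ Inl i) - (\<Sum>j\<in>UNIV. x $ Inr j * y $ Inr j)"

text \<open>
  Finite-dimensional real vector spaces are finite-dimensional subspaces of an arbitrary
  ambient type of class \<open>real_vector\<close>; maps and forms are only constrained on the subspace.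
\<close>

definition fin_dim_subspace :: "'u::real_vector set \<Rightarrow> bool"
  where "fin_dim_subspace U \<longleftrightarrow> subspace U \<and> (\<exists>S. finite S \<and> U = span S)"

definition linear_between ::
    "'u::real_vector set \<Rightarrow> 'v::real_vector set \<Rightarrow> ('u \<Rightarrow> 'v) \<Rightarrow> bool"
  where "linear_between U V f \<longleftrightarrow>
    (\<forall>x\<in>U. f x \<in> V) \<and>
    (\<forall>x\<in>U. \<forall>y\<in>U. f (x + y) = f x + f y) \<and>
    (\<forall>c. \<forall>x\<in>U. f (c *\<^sub>R x) = c *\<^sub>R f x)"

definition clifford_module ::
    "'u::real_vector set \<Rightarrow> (real ^ ('r::finite + 's::finite) \<Rightarrow> 'u \<Rightarrow> 'u) \<Rightarrow> bool"
  where "clifford_module U J \<longleftrightarrow>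
    fin_dim_subspace U \<and>
    (\<forall>z. linear_between U U (J z)) \<and>
    (\<forall>x\<in>U. linear (\<lambda>z. J z x)) \<and>
    (\<forall>z. \<forall>x\<in>U. J z (J z x) = - pseudo_inner z z *\<^sub>R x)"

definition nondegenerate_symmetric_form :: "'u::real_vector set \<Rightarrow> ('u \<Rightarrow> 'u \<Rightarrow> real) \<Rightarrow> bool"
  where "nondegenerate_symmetric_form U B \<longleftrightarrow>
    (\<forall>x\<in>U. linear_between U UNIV (B x)) \<and>
    (\<forall>x\<in>U. \<forall>y\<in>U. B x y = B y x) \<and>
    (\<forall>x\<in>U. (\<forall>y\<in>U. B x y = 0) \<longrightarrow> x = 0)"

definition admissible_module ::
    "'u::real_vector set \<Rightarrow> (real ^ ('r::finite + 's::finite) \<Rightarrow> 'u \<Rightarrow> 'u)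
      \<Rightarrow> ('u \<Rightarrow> 'u \<Rightarrow> real) \<Rightarrow> bool"
  where "admissible_module U J B \<longleftrightarrow>
    clifford_module U J \<and>
    nondegenerate_symmetric_form U B \<and>
    (\<forall>z. \<forall>x\<in>U. \<forall>y\<in>U. B (J z x) y + B x (J z y) = 0)"

text \<open>
  A definition cannot quantify over types, so the competing modules range over the subspaces
  of one fixed space of countably infinite dimension. Every finite-dimensional real vector
  space embeds into it, so nothing is lost; see \<open>minimal_admissible_module_le\<close> below.
\<close>

definition minimal_admissible_module ::
    "'u::real_vector set \<Rightarrow> (real ^ ('r::finite + 's::finite) \<Rightarrow> 'u \<Rightarrow> 'u)
      \<Rightarrow> ('u \<Rightarrow> 'u \<Rightarrow> real) \<Rightarrow> bool"
  where "minimal_admissible_module U J B \<longleftrightarrow>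
    admissible_module U J B \<and> U \<noteq> {0} \<and>
    (\<forall>(U' :: (nat \<Rightarrow>\<^sub>0 real) set) (J' :: real ^ ('r + 's) \<Rightarrow> _ \<Rightarrow> _) B'.
      admissible_module U' J' B' \<and> U' \<noteq> {0} \<longrightarrow> dim U \<le> dim U')"

definition center_bracket ::
    "(real ^ ('r::finite + 's::finite) \<Rightarrow> 'u \<Rightarrow> 'u) \<Rightarrow> ('u \<Rightarrow> 'u \<Rightarrow> real)
      \<Rightarrow> 'u \<Rightarrow> 'u \<Rightarrow> real ^ ('r + 's)"
  where "center_bracket J B x y = (THE w. \<forall>z. B (J z x) y = pseudo_inner z w)"

definition pseudo_H_carrier :: "'u set \<Rightarrow> ('u \<times> (real ^ ('r::finite + 's::finite))) set"
  where "pseudo_H_carrier U = U \<times> UNIV"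

definition pseudo_H_bracket ::
    "(real ^ ('r::finite + 's::finite) \<Rightarrow> 'u \<Rightarrow> 'u) \<Rightarrow> ('u::real_vector \<Rightarrow> 'u \<Rightarrow> real)
      \<Rightarrow> 'u \<times> (real ^ ('r + 's)) \<Rightarrow> 'u \<times> (real ^ ('r + 's)) \<Rightarrow> 'u \<times> (real ^ ('r + 's))"
  where "pseudo_H_bracket J B p q = (0, center_bracket J B (fst p) (fst q))"

definition lie_isomorphic ::
    "'a::real_vector set \<Rightarrow> ('a \<Rightarrow> 'a \<Rightarrow> 'a) \<Rightarrow> 'b::real_vector set \<Rightarrow> ('b \<Rightarrow> 'b \<Rightarrow> 'b) \<Rightarrow> bool"
  where "lie_isomorphic L br L' br' \<longleftrightarrow>
    (\<exists>f. linear_between L L' f \<and> bij_betw f L L' \<and>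
         (\<forall>x\<in>L. \<forall>y\<in>L. f (br x y) = br' (f x) (f y)))"

lemma pseudo_inner_axis:
  fixes w :: "real ^ ('r::finite + 's::finite)"
  shows "pseudo_inner (axis (Inl i) 1) w = w $ Inl i"
    and "pseudo_inner (axis (Inr j) 1) w = - (w $ Inr j)"
  by (simp_all add: pseudo_inner_def axis_def if_distrib [of "\<lambda>t. t * _"] cong: if_cong)

lemma pseudo_inner_cancel:
  fixes w w' :: "real ^ ('r::finite + 's::finite)"
  assumes "\<And>z. pseudo_inner z w = pseudo_inner z w'"
  shows "w = w'"
proof (rule vec_eq_iff [THEN iffD2], rule allI)
  fix k show "w $ k = w' $ k"
    using assms [of "axis k 1"] by (cases k) (auto simp: pseudo_inner_axis)
qed

lemma center_bracket:
  fixes J :: "real ^ ('r::finite + 's::finite) \<Rightarrow> 'u::real_vector \<Rightarrow> 'u"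
  assumes adm: "admissible_module U J B" and x: "x \<in> U" and y: "y \<in> U"
  shows "B (J z x) y = pseudo_inner z (center_bracket J B x y)"
proof -
  define f where "f = (\<lambda>z. B (J z x) y)"
  have JU: "J z x \<in> U" for z
    using adm x by (auto simp: admissible_module_def clifford_module_def linear_between_def)
  have f: "f z = B y (J z x)" for z
    using adm JU y by (auto simp: f_def admissible_module_def nondegenerate_symmetric_form_def)
  have linJ: "linear (\<lambda>z. J z x)"
    using adm x by (auto simp: admissible_module_def clifford_module_def)
  have "linear_between U UNIV (B y)"
    using adm y by (auto simp: admissible_module_def nondegenerate_symmetric_form_def)
  then have lin: "linear f"
    using JU linear_add [OF linJ] linear_scale [OF linJ]
    by (intro linearI) (auto simp: f linear_between_def)
  define w :: "real ^ ('r + 's)"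
    where "w = (\<chi> k. case k of Inl i \<Rightarrow> f (axis k 1) | Inr j \<Rightarrow> - f (axis k 1))"
  have w: "f z = pseudo_inner z w" for z
  proof -
    have "f z = f (\<Sum>k\<in>UNIV. z $ k *\<^sub>R axis k 1)"
      by (metis basis_expansion scalar_mult_eq_scaleR)
    also have "\<dots> = (\<Sum>k\<in>UNIV. z $ k * f (axis k 1))"
      by (simp add: linear_sum [OF lin] linear_scale [OF lin])
    also have "\<dots> = (\<Sum>k\<in>Inl ` UNIV. z $ k * f (axis k 1)) + (\<Sum>k\<in>Inr ` UNIV. z $ k * f (axis k 1))"
      by (subst UNIV_sum, rule sum.union_disjoint) auto
    also have "\<dots> = pseudo_inner z w"
      by (simp add: sum.reindex pseudo_inner_def w_def sum_negf)
    finally show ?thesis .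
  qed
  have "\<exists>!w. \<forall>z. B (J z x) y = pseudo_inner z w"
    using w pseudo_inner_cancel unfolding f_def by metis
  from theI' [OF this] show ?thesis
    unfolding center_bracket_def by (rule spec)
qed

lemma minimal_admissible_module_le:
  fixes J :: "real ^ ('r::finite + 's::finite) \<Rightarrow> 'u::real_vector \<Rightarrow> 'u"
    and J' :: "real ^ ('r + 's) \<Rightarrow> 'v::real_vector \<Rightarrow> 'v"
  assumes min: "minimal_admissible_module U J B"
    and adm: "admissible_module V J' B'" and nz: "V \<noteq> {0}"
  shows "dim U \<le> dim V"
proof -
  have subV: "subspace V" and "\<exists>S. finite S \<and> V = span S"
    using adm by (auto simp: admissible_module_def clifford_module_def fin_dim_subspace_def)
  then obtain S where S: "finite S" "V = span S" by auto
  obtain A where A: "A \<subseteq> S" "independent A" "span A = V"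
    using maximal_independent_subset [of S] S
    by (metis span_eq span_superset dual_order.trans)
  have finA: "finite A" using A S finite_subset by blast
  then obtain e :: "'v \<Rightarrow> nat" where e: "inj_on e A"
    using finite_imp_inj_to_nat_seg by blast
  define b :: "'v \<Rightarrow> (nat \<Rightarrow>\<^sub>0 real)" where "b = (\<lambda>a. Poly_Mapping.single (e a) 1)"
  obtain h where h: "linear h" "\<And>a. a \<in> A \<Longrightarrow> h a = b a"
    using linear_independent_extend [OF A(2), of b] by blast
  have lookup_h: "Poly_Mapping.lookup (h (\<Sum>a\<in>A. c a *\<^sub>R a)) (e a) = c a" if "a \<in> A" for c a
  proof -
    have scale: "Poly_Mapping.lookup (t *\<^sub>R p) n = t * Poly_Mapping.lookup p n"
      for t and p :: "nat \<Rightarrow>\<^sub>0 real" and n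
    proof -
      have "finite {i. t *\<^sub>R Poly_Mapping.lookup p i \<noteq> 0}"
        by (rule finite_subset [OF _ finite_lookup [of p]]) auto
      then show ?thesis
        by (simp add: scaleR_poly_mapping_def)
    qed
    have look: "Poly_Mapping.lookup (\<Sum>a\<in>T. c a *\<^sub>R b a) n = (\<Sum>a\<in>T. c a * Poly_Mapping.lookup (b a) n)"
      if "finite T" for T n
      using that by (induction T rule: finite_induct) (auto simp: lookup_add scale)
    have "h (\<Sum>a\<in>A. c a *\<^sub>R a) = (\<Sum>a\<in>A. c a *\<^sub>R b a)"
      by (simp add: linear_sum [OF h(1)] linear_scale [OF h(1)] h(2))
    then have "Poly_Mapping.lookup (h (\<Sum>a\<in>A. c a *\<^sub>R a)) (e a) = (\<Sum>a'\<in>A. c a' * Poly_Mapping.lookup (b a') (e a))"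
      using look [OF finA] by simp
    also have "\<dots> = (\<Sum>a'\<in>A. if a' = a then c a' else 0)"
      using e that by (intro sum.cong) (auto simp: b_def lookup_single when_def inj_on_def)
    finally show ?thesis using finA that by simp
  qed
  have ker: "x = 0" if "x \<in> V" "h x = 0" for x
  proof -
    obtain c where c: "x = (\<Sum>a\<in>A. c a *\<^sub>R a)"
      using \<open>x \<in> V\<close> A(3) span_finite [OF finA] by auto
    have "c a = 0" if "a \<in> A" for a
      using lookup_h [OF that, of c] \<open>h x = 0\<close> c by simp
    then show ?thesis using c by simp
  qed
  have injh: "inj_on h V"
    using ker linear_injective_on_subspace_0 [OF h(1) subV] by blast
  define W where "W = h ` V"
  define g where "g = the_inv_into V h"
  have gh: "g (h x) = x" if "x \<in> V" for x
    using the_inv_into_f_f [OF injh that] by (simp add: g_def)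
  have lh: "h (x + y) = h x + h y" "h (c *\<^sub>R x) = c *\<^sub>R h x" for x y c
    using linear_add [OF h(1)] linear_scale [OF h(1)] by auto
  have V: "x + y \<in> V" "c *\<^sub>R x \<in> V" if "x \<in> V" "y \<in> V" for x y c
    using subV that by (auto simp: subspace_add subspace_scale)
  have gadd: "g (h x + h y) = x + y" "g (c *\<^sub>R h x) = c *\<^sub>R x" if "x \<in> V" "y \<in> V" for x y c
    using gh [OF V(1) [OF that]] gh [OF V(2) [OF that]] by (simp_all add: lh)
  define K where "K = (\<lambda>z w. h (J' z (g w)))"
  define C where "C = (\<lambda>v w. B' (g v) (g w))"
  note defs = admissible_module_def clifford_module_def nondegenerate_symmetric_form_def
    linear_between_def
  have sq: "J' z (J' z x) = - pseudo_inner z z *\<^sub>R x" if "x \<in> V" for z x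
    using adm that by (simp add: admissible_module_def clifford_module_def)
  have formV: "nondegenerate_symmetric_form V B'"
    using adm by (simp add: admissible_module_def)
  have J'V: "J' z x \<in> V" if "x \<in> V" for z x
    using adm that by (auto simp: defs)
  have "fin_dim_subspace W"
    unfolding fin_dim_subspace_def W_def using S linear_span_image [OF h(1)]
    by (metis finite_imageI subspace_span)
  moreover have "\<forall>z. linear_between W W (K z)"
    using adm J'V unfolding linear_between_def W_def K_def
    by (auto simp: defs gh gadd lh)
  moreover have "\<forall>w\<in>W. linear (\<lambda>z. K z w)"
  proof
    fix w assume "w \<in> W"
    then obtain x where x: "x \<in> V" "w = h x" by (auto simp: W_def)
    have "linear (\<lambda>z. J' z x)" using adm x by (auto simp: defs)
    from linear_compose [OF this h(1)] show "linear (\<lambda>z. K z w)"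
      using x by (simp add: K_def gh o_def)
  qed
  moreover have "\<forall>z. \<forall>w\<in>W. K z (K z w) = - pseudo_inner z z *\<^sub>R w"
  proof (intro allI ballI)
    fix z w assume "w \<in> W"
    then obtain x where x: "x \<in> V" "w = h x" by (auto simp: W_def)
    show "K z (K z w) = - pseudo_inner z z *\<^sub>R w"
      using x J'V by (simp only: K_def gh lh sq)
  qed
  ultimately have "clifford_module W K" by (simp add: clifford_module_def)
  moreover have "nondegenerate_symmetric_form W C"
  proof -
    have "x = 0" if "x \<in> V" "\<forall>y\<in>V. B' x y = 0" for x
      using formV that by (simp add: nondegenerate_symmetric_form_def)
    then have "h x = 0" if "x \<in> V" "\<forall>y\<in>V. B' x y = 0" for x
      using that linear_0 [OF h(1)] by metis
    moreover have "B' x y = B' y x" if "x \<in> V" "y \<in> V" for x y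
      using formV that by (simp add: nondegenerate_symmetric_form_def)
    moreover have "B' x (y + y') = B' x y + B' x y'" "B' x (c *\<^sub>R y) = c *\<^sub>R B' x y"
      if "x \<in> V" "y \<in> V" "y' \<in> V" for x y y' c
      using formV that by (simp_all add: nondegenerate_symmetric_form_def linear_between_def)
    ultimately show ?thesis
      unfolding nondegenerate_symmetric_form_def linear_between_def W_def C_def
      by (simp add: gh gadd)
  qed
  moreover have "\<forall>z. \<forall>x\<in>W. \<forall>y\<in>W. C (K z x) y + C x (K z y) = 0"
    using adm J'V unfolding W_def C_def K_def by (auto simp: defs gh)
  ultimately have "admissible_module W K C" by (simp add: admissible_module_def)
  moreover have "W \<noteq> {0}"
  proof -
    obtain x where "x \<in> V" "x \<noteq> 0" using nz subspace_0 [OF subV] by blast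
    then have "h x \<in> W" "h x \<noteq> 0" using ker by (auto simp: W_def)
    then show ?thesis by blast
  qed
  ultimately have "dim U \<le> dim W"
    using min unfolding minimal_admissible_module_def by blast
  also have "dim W \<le> card (h ` A)"
    using finA A(3) linear_span_image [OF h(1), of A] by (intro dim_le_card) (auto simp: W_def)
  also have "\<dots> \<le> card A" using finA by (rule card_image_le)
  also have "card A = dim V" using A(2,3) by (metis dim_eq_card_independent dim_span)
  finally show ?thesis .
qed

end

theory Submission
  imports Defs
begin

text \<open>
  A minimal admissible module \<open>U\<close> is generated by any vector \<open>v\<close> whose orbit under the products
  of generators spans a nondegenerate subspace. Some such products are commuting symmetric
  involutions; a common eigenvector \<open>v\<close> of them with \<open>\<langle>v, v\<rangle> \<noteq> 0\<close>, rotated so that a few symmetric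
  complex structures \<open>N\<close> satisfy \<open>\<langle>N v, v\<rangle> = 0\<close>, has an orbit with \<open>\<langle>w v, v\<rangle>\<close> equal to \<open>0\<close> or
  \<open>\<plusminus>\<langle>v, v\<rangle>\<close> for every word \<open>w\<close>, so that the orbit is, up to signs, an orthogonal basis of \<open>U\<close>.

  The Lie algebra only depends on the skew forms \<open>\<langle>J\<^sub>z x, y\<rangle>\<close>. On the module \<open>V\<close> for the opposite
  signature the squares of the generators \<open>K\<^sub>i\<close> have the opposite signs, and therefore the products
  \<open>J\<^sub>i J\<^sub>j\<close> obey the same relations as \<open>- K\<^sub>i K\<^sub>j\<close>. If \<open>v'\<close> is the special vector of \<open>V\<close>, then
  \<open>u = v' + K\<^sub>1 K\<^sub>2 K\<^sub>3 v'\<close> satisfies \<open>\<langle>w v, v\<rangle> = \<kappa> (- 1)\<^sup>k \<langle>w u, u\<rangle>\<close> for all words \<open>w\<close> of odd length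
  \<open>2k + 1\<close>. As \<open>v\<close> and \<open>u\<close> are cyclic already for the words of even length, sending \<open>w v\<close> to
  \<open>(- 1)\<^sup>k w u\<close> for the words \<open>w\<close> of even length \<open>2k\<close> is a bijection that carries the skew forms of
  \<open>U\<close> to multiples of those of \<open>V\<close>. The finitely many sign identities are checked by computation.
\<close>

subsection \<open>Words in anticommuting generators\<close>

abbreviation word_act :: "(nat \<Rightarrow> 'u \<Rightarrow> 'u) \<Rightarrow> nat list \<Rightarrow> 'u \<Rightarrow> 'u"
  where "word_act g w x \<equiv> foldr g w x"

fun clif_insert :: "(nat \<Rightarrow> int) \<Rightarrow> nat \<Rightarrow> nat list \<Rightarrow> int \<times> nat list" where
  "clif_insert s i [] = (1, [i])"
| "clif_insert s i (x # xs) =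
    (if i < x then (1, i # x # xs)
     else if i = x then (s i, xs)
     else (case clif_insert s i xs of (c, ys) \<Rightarrow> (- c, x # ys)))"

text \<open>
  Rewrites a product of generators with \<open>g\<^sub>i\<^sup>2 = s\<^sub>i\<close> as a sign times an increasing product.
\<close>

fun clif_norm :: "(nat \<Rightarrow> int) \<Rightarrow> nat list \<Rightarrow> int \<times> nat list" where
  "clif_norm s [] = (1, [])"
| "clif_norm s (i # w) =
    (case clif_norm s w of (c, ys) \<Rightarrow> (case clif_insert s i ys of (d, zs) \<Rightarrow> (c * d, zs)))"

text \<open>The value \<open>0\<close> means that the two words are not proportional.\<close>

definition clif_ratio :: "(nat \<Rightarrow> int) \<Rightarrow> nat list \<Rightarrow> nat list \<Rightarrow> int" where
  "clif_ratio s w u = (case clif_norm s w of (c, x) \<Rightarrow> (case clif_norm s u of (d, y) \<Rightarrow>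
     if x = y then c * d else 0))"

text \<open>The generators are skew, so the adjoint of a word is its reversal times
  \<open>(- 1) ^ length w\<close>. The equation therefore makes the operator of \<open>w\<close>
  self-adjoint, and the one in \<open>skew_word\<close> makes it anti-self-adjoint; both can be
  decided on normal forms.\<close>

definition sym_word :: "(nat \<Rightarrow> int) \<Rightarrow> nat list \<Rightarrow> bool" where
  "sym_word s w \<longleftrightarrow> clif_ratio s (rev w) w = (- 1) ^ length w"

definition skew_word :: "(nat \<Rightarrow> int) \<Rightarrow> nat list \<Rightarrow> bool" where
  "skew_word s w \<longleftrightarrow> clif_ratio s (rev w) w = - ((- 1) ^ length w)"

definition comm_sign :: "(nat \<Rightarrow> int) \<Rightarrow> nat list \<Rightarrow> nat list \<Rightarrow> int" where
  "comm_sign s w u = clif_ratio s (w @ u) (u @ w)"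

lemma clif_insert_strict_sorted:
  "clif_insert s i xs = (c, zs) \<Longrightarrow> sorted_wrt (<) xs \<Longrightarrow>
    set zs \<subseteq> insert i (set xs) \<and> sorted_wrt (<) zs"
proof (induction xs arbitrary: c zs)
  case (Cons x xs)
  show ?case
  proof (cases "i < x \<or> i = x")
    case True
    then show ?thesis using Cons.prems by (fastforce split: if_splits)
  next
    case False
    then obtain d ys where d: "clif_insert s i xs = (d, ys)" and "zs = x # ys"
      using Cons.prems by (auto split: prod.splits)
    with Cons.IH [OF d] Cons.prems(2) False show ?thesis by auto
  qed
qed auto

lemma clif_insert_sign:
  "clif_insert s i xs = (c, zs) \<Longrightarrow> (\<And>i. s i = 1 \<or> s i = - 1) \<Longrightarrow> c = 1 \<or> c = - 1"
proof (induction xs arbitrary: c zs)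
  case (Cons x xs)
  show ?case
  proof (cases "i < x \<or> i = x")
    case True
    then show ?thesis using Cons.prems(1) Cons.prems(2) [of i] by (auto split: if_splits)
  next
    case False
    then obtain d ys where d: "clif_insert s i xs = (d, ys)" and "c = - d"
      using Cons.prems(1) by (auto split: prod.splits)
    with Cons.IH [OF d Cons.prems(2)] show ?thesis by auto
  qed
qed auto

text \<open>Reversing all squares is felt exactly when the inserted letter cancels against an equal
  one, and the change of length records whether this happens.\<close>

lemma clif_insert_minus:
  "clif_insert s i xs = (c, zs) \<Longrightarrow>
    (length zs = Suc (length xs) \<and> clif_insert (\<lambda>i. - s i) i xs = (c, zs)) \<or>
    (Suc (length zs) = length xs \<and> clif_insert (\<lambda>i. - s i) i xs = (- c, zs))"
proof (induction xs arbitrary: c zs)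
  case (Cons x xs)
  show ?case
  proof (cases "i < x \<or> i = x")
    case True
    then show ?thesis using Cons.prems by (auto split: if_splits)
  next
    case False
    then obtain d ys where d: "clif_insert s i xs = (d, ys)" and "zs = x # ys" "c = - d"
      using Cons.prems by (auto split: prod.splits)
    with Cons.IH [OF d] False show ?thesis by auto
  qed
qed auto

lemma clif_norm_strict_sorted:
  "clif_norm s w = (c, zs) \<Longrightarrow> set zs \<subseteq> set w \<and> sorted_wrt (<) zs"
proof (induction w arbitrary: c zs)
  case (Cons i w)
  obtain d ys where d: "clif_norm s w = (d, ys)" by fastforce
  obtain e xs where e: "clif_insert s i ys = (e, xs)" by fastforce
  have "xs = zs" using Cons.prems d e by simp
  then show ?case
    using Cons.IH [OF d] clif_insert_strict_sorted [OF e] by auto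
qed auto

lemma clif_norm_sign:
  "clif_norm s w = (c, zs) \<Longrightarrow> (\<And>i. s i = 1 \<or> s i = - 1) \<Longrightarrow> c = 1 \<or> c = - 1"
proof (induction w arbitrary: c zs)
  case (Cons i w)
  obtain d ys where d: "clif_norm s w = (d, ys)" by fastforce
  obtain e xs where e: "clif_insert s i ys = (e, xs)" by fastforce
  have "c = d * e" using Cons.prems d e by simp
  then show ?case
    using Cons.IH [OF d Cons.prems(2)] clif_insert_sign [OF e Cons.prems(2)] by auto
qed auto

text \<open>Here \<open>t\<close> counts cancellations: each removes two letters and contributes one
  square. This is the source of the sign \<open>(- 1) ^ t\<close> between the two
  signatures.\<close>

lemma clif_norm_minus:
  "clif_norm s w = (c, zs) \<Longrightarrow>
    \<exists>t. length w = length zs + 2 * t \<and> clif_norm (\<lambda>i. - s i) w = ((- 1) ^ t * c, zs)"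
proof (induction w arbitrary: c zs)
  case (Cons i w)
  obtain d ys where d: "clif_norm s w = (d, ys)" by fastforce
  obtain e xs where e: "clif_insert s i ys = (e, xs)" by fastforce
  have c: "c = d * e" "xs = zs" using Cons.prems d e by simp_all
  obtain t where t: "length w = length ys + 2 * t" "clif_norm (\<lambda>i. - s i) w = ((- 1) ^ t * d, ys)"
    using Cons.IH [OF d] by blast
  from clif_insert_minus [OF e] show ?case
  proof
    assume "length xs = Suc (length ys) \<and> clif_insert (\<lambda>i. - s i) i ys = (e, xs)"
    then show ?thesis using t c by (intro exI [of _ t]) auto
  next
    assume "Suc (length xs) = length ys \<and> clif_insert (\<lambda>i. - s i) i ys = (- e, xs)"
    then show ?thesis using t c by (intro exI [of _ "Suc t"]) auto
  qed
qed auto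

text \<open>This reduces statements about all words over \<open>L\<close> to the finitely many
  normal forms in \<open>subseqs L\<close>, where they can be checked by evaluation.\<close>

lemma strict_sorted_in_subseqs:
  fixes L :: "nat list"
  shows "sorted_wrt (<) L \<Longrightarrow> sorted_wrt (<) zs \<Longrightarrow> set zs \<subseteq> set L \<Longrightarrow> zs \<in> set (subseqs L)"
proof (induction L arbitrary: zs)
  case (Cons x xs)
  show ?case
  proof (cases "x \<in> set zs")
    case True
    then obtain y ys where zs: "zs = y # ys" by (cases zs) auto
    have "y = x" using True Cons.prems zs by fastforce
    moreover have "ys \<in> set (subseqs xs)"
      using Cons.prems zs \<open>y = x\<close> by (intro Cons.IH) auto
    ultimately show ?thesis using zs by (simp add: Let_def)
  next
    case False
    then have "zs \<in> set (subseqs xs)" using Cons.prems by (intro Cons.IH) auto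
    then show ?thesis by (simp add: Let_def)
  qed
qed auto

lemma set_concat_subseqs:
  assumes "Q \<in> set (map concat (subseqs Ps))" and "\<And>P. P \<in> set Ps \<Longrightarrow> R P"
  obtains Rs where "Q = concat Rs" "\<And>P. P \<in> set Rs \<Longrightarrow> R P"
proof -
  obtain Rs where "Rs \<in> set (subseqs Ps)" "Q = concat Rs" using assms(1) by auto
  moreover have "set Rs \<subseteq> set Ps"
    using \<open>Rs \<in> _\<close> subseqs_powset [of Ps] by blast
  ultimately show ?thesis using that assms(2) by blast
qed

subsection \<open>Clifford families with an invariant form\<close>

text \<open>Generators carry natural numbers as labels and integer signs as squares, so that the
  arithmetic of words is executable. The order on \<open>L\<close> turns the normal forms over
  \<open>L\<close> into members of \<open>subseqs L\<close>.\<close>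

locale clifford_family =
  fixes U :: "'u::real_vector set" and B :: "'u \<Rightarrow> 'u \<Rightarrow> real"
    and g :: "nat \<Rightarrow> 'u \<Rightarrow> 'u" and s :: "nat \<Rightarrow> int" and L :: "nat list"
  assumes subspace_U: "subspace U"
    and form: "nondegenerate_symmetric_form U B"
    and gen_linear: "i \<in> set L \<Longrightarrow> linear_between U U (g i)"
    and gen_square: "i \<in> set L \<Longrightarrow> x \<in> U \<Longrightarrow> g i (g i x) = of_int (s i) *\<^sub>R x"
    and gen_anticommute: "i \<in> set L \<Longrightarrow> j \<in> set L \<Longrightarrow> i \<noteq> j \<Longrightarrow> x \<in> U \<Longrightarrow> g i (g j x) = - g j (g i x)"
    and gen_skew: "i \<in> set L \<Longrightarrow> x \<in> U \<Longrightarrow> y \<in> U \<Longrightarrow> B (g i x) y = - B x (g i y)"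
    and sign: "s i = 1 \<or> s i = - 1"
    and sorted_L: "sorted_wrt (<) L"
begin

lemma form_sym: "x \<in> U \<Longrightarrow> y \<in> U \<Longrightarrow> B x y = B y x"
  using form by (simp add: nondegenerate_symmetric_form_def)

lemma form_nondegenerate: "x \<in> U \<Longrightarrow> (\<And>y. y \<in> U \<Longrightarrow> B x y = 0) \<Longrightarrow> x = 0"
  using form by (simp add: nondegenerate_symmetric_form_def)

lemma in_U: "x \<in> U \<Longrightarrow> y \<in> U \<Longrightarrow> x + y \<in> U" "x \<in> U \<Longrightarrow> c *\<^sub>R x \<in> U"
  "x \<in> U \<Longrightarrow> y \<in> U \<Longrightarrow> x - y \<in> U" "x \<in> U \<Longrightarrow> - x \<in> U" "0 \<in> U"
  using subspace_U by (auto simp: subspace_add subspace_scale subspace_diff subspace_neg subspace_0)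

lemma form_right: "x \<in> U \<Longrightarrow> y \<in> U \<Longrightarrow> z \<in> U \<Longrightarrow> B x (y + z) = B x y + B x z"
  "x \<in> U \<Longrightarrow> y \<in> U \<Longrightarrow> B x (c *\<^sub>R y) = c * B x y"
  using form by (simp_all add: nondegenerate_symmetric_form_def linear_between_def)

lemma form_left: "x \<in> U \<Longrightarrow> y \<in> U \<Longrightarrow> z \<in> U \<Longrightarrow> B (y + z) x = B y x + B z x"
  "x \<in> U \<Longrightarrow> y \<in> U \<Longrightarrow> B (c *\<^sub>R y) x = c * B y x"
  by (simp_all add: form_sym [of _ x] form_right in_U)

lemma form_minus: "x \<in> U \<Longrightarrow> y \<in> U \<Longrightarrow> B x (- y) = - B x y"
  "x \<in> U \<Longrightarrow> y \<in> U \<Longrightarrow> B (- y) x = - B y x"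
  using form_right(2) [of x y "- 1"] form_left(2) [of x y "- 1"] by simp_all

lemmas form_simps = form_right form_left form_minus

lemma gen_closed: "i \<in> set L \<Longrightarrow> x \<in> U \<Longrightarrow> g i x \<in> U"
  using gen_linear by (auto simp: linear_between_def)

lemma gen_add: "i \<in> set L \<Longrightarrow> x \<in> U \<Longrightarrow> y \<in> U \<Longrightarrow> g i (x + y) = g i x + g i y"
  using gen_linear by (auto simp: linear_between_def)

lemma gen_scale: "i \<in> set L \<Longrightarrow> x \<in> U \<Longrightarrow> g i (c *\<^sub>R x) = c *\<^sub>R g i x"
  using gen_linear by (auto simp: linear_between_def)

lemma act_closed: "set w \<subseteq> set L \<Longrightarrow> x \<in> U \<Longrightarrow> word_act g w x \<in> U"
  by (induction w) (auto intro: gen_closed)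

lemma act_add: "set w \<subseteq> set L \<Longrightarrow> x \<in> U \<Longrightarrow> y \<in> U \<Longrightarrow>
    word_act g w (x + y) = word_act g w x + word_act g w y"
  by (induction w) (auto simp: gen_add act_closed)

lemma act_scale: "set w \<subseteq> set L \<Longrightarrow> x \<in> U \<Longrightarrow> word_act g w (c *\<^sub>R x) = c *\<^sub>R word_act g w x"
  by (induction w) (auto simp: gen_scale act_closed)

lemma act_minus: "set w \<subseteq> set L \<Longrightarrow> x \<in> U \<Longrightarrow> word_act g w (- x) = - word_act g w x"
  using act_scale [of w x "- 1"] by simp

lemma act_insert:
  assumes "i \<in> set L" "x \<in> U"
  shows "clif_insert s i xs = (c, zs) \<Longrightarrow> set xs \<subseteq> set L \<Longrightarrow>
    set zs \<subseteq> set L \<and> word_act g (i # xs) x = of_int c *\<^sub>R word_act g zs x"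
proof (induction xs arbitrary: c zs)
  case Nil
  then show ?case using assms by auto
next
  case (Cons y xs)
  have X: "word_act g xs x \<in> U" using Cons.prems assms by (auto intro: act_closed)
  consider "i < y" | "i = y" | "i > y" by linarith
  then show ?case
  proof cases
    case 3
    obtain d ys where d: "clif_insert s i xs = (d, ys)" by fastforce
    have zs: "zs = y # ys" "c = - d" using 3 Cons.prems d by simp_all
    have IH: "set ys \<subseteq> set L" "word_act g (i # xs) x = of_int d *\<^sub>R word_act g ys x"
      using Cons.IH [OF d] Cons.prems by auto
    have "word_act g (i # y # xs) x = - g y (g i (word_act g xs x))"
      using 3 Cons.prems assms X gen_anticommute [of i y "word_act g xs x"] by simp
    also have "g i (word_act g xs x) = of_int d *\<^sub>R word_act g ys x" using IH by simp
    finally show ?thesis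
      using zs IH Cons.prems assms by (simp add: gen_scale act_closed)
  qed (use Cons.prems assms X in \<open>auto simp: gen_square\<close>)
qed

lemma act_norm:
  assumes "x \<in> U"
  shows "clif_norm s w = (c, zs) \<Longrightarrow> set w \<subseteq> set L \<Longrightarrow>
    set zs \<subseteq> set L \<and> word_act g w x = of_int c *\<^sub>R word_act g zs x"
proof (induction w arbitrary: c zs)
  case Nil
  then show ?case by auto
next
  case (Cons i w)
  obtain d ys where d: "clif_norm s w = (d, ys)" by fastforce
  obtain e xs where e: "clif_insert s i ys = (e, xs)" by fastforce
  have c: "c = d * e" "xs = zs" using Cons.prems d e by simp_all
  have IH: "set ys \<subseteq> set L" "word_act g w x = of_int d *\<^sub>R word_act g ys x"
    using Cons.IH [OF d] Cons.prems by auto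
  have i: "set zs \<subseteq> set L" "word_act g (i # ys) x = of_int e *\<^sub>R word_act g zs x"
    using act_insert [OF _ assms e] Cons.prems IH c by auto
  have "word_act g (i # w) x = of_int d *\<^sub>R word_act g (i # ys) x"
    using IH Cons.prems assms by (simp add: gen_scale act_closed)
  then show ?case using i c by simp
qed

lemma norm_in_subseqs:
  assumes "clif_norm s w = (c, zs)" "set w \<subseteq> set L"
  shows "zs \<in> set (subseqs L)"
  using clif_norm_strict_sorted [OF assms(1)] assms(2) sorted_L
  by (auto intro: strict_sorted_in_subseqs)

lemma subseqs_subset: "M \<in> set (subseqs L) \<Longrightarrow> set M \<subseteq> set L"
  using subseqs_powset [of L] by blast

text \<open>Both words are signs times the same normal form. Signs are their own inverses, so the
  product of the two signs is also their quotient.\<close>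

lemma act_ratio:
  assumes "clif_ratio s w u = r" "r \<noteq> 0" "set w \<subseteq> set L" "set u \<subseteq> set L" "x \<in> U"
  shows "word_act g w x = of_int r *\<^sub>R word_act g u x" "r = 1 \<or> r = - 1"
proof -
  obtain c y where c: "clif_norm s w = (c, y)" by fastforce
  obtain d z where d: "clif_norm s u = (d, z)" by fastforce
  have r: "y = z" "r = c * d" using assms(1,2) c d by (auto simp: clif_ratio_def split: if_splits)
  have sg: "c = 1 \<or> c = - 1" "d = 1 \<or> d = - 1"
    using clif_norm_sign [OF c] clif_norm_sign [OF d] sign by auto
  show "r = 1 \<or> r = - 1" using sg r by auto
  show "word_act g w x = of_int r *\<^sub>R word_act g u x"
    using act_norm [OF assms(5) c assms(3)] act_norm [OF assms(5) d assms(4)] sg r by auto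
qed

lemma act_adjoint:
  "set w \<subseteq> set L \<Longrightarrow> x \<in> U \<Longrightarrow> y \<in> U \<Longrightarrow>
    B (word_act g w x) y = (- 1) ^ length w * B x (word_act g (rev w) y)"
  by (induction w arbitrary: y) (auto simp: gen_skew act_closed gen_closed)

lemma sym_word:
  assumes "sym_word s w" "set w \<subseteq> set L" "x \<in> U" "y \<in> U"
  shows "B (word_act g w x) y = B x (word_act g w y)"
proof -
  have "word_act g (rev w) y = of_int ((- 1) ^ length w) *\<^sub>R word_act g w y"
    using assms by (intro act_ratio) (auto simp: sym_word_def)
  then have "B (word_act g w x) y
      = (- 1) ^ length w * B x (of_int ((- 1) ^ length w) *\<^sub>R word_act g w y)"
    using assms by (simp only: act_adjoint)
  also have "\<dots> = B x (word_act g w y)"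
    using assms by (subst form_right) (auto simp: act_closed simp flip: power_mult_distrib)
  finally show ?thesis .
qed

lemma skew_word:
  assumes "skew_word s w" "set w \<subseteq> set L" "x \<in> U"
  shows "B (word_act g w x) x = 0"
proof -
  have "word_act g (rev w) x = of_int (- ((- 1) ^ length w)) *\<^sub>R word_act g w x"
    using assms by (intro act_ratio) (auto simp: skew_word_def)
  then have "B (word_act g w x) x
      = (- 1) ^ length w * B x (of_int (- ((- 1) ^ length w)) *\<^sub>R word_act g w x)"
    using assms by (simp only: act_adjoint)
  also have "\<dots> = - B x (word_act g w x)"
    using assms by (subst form_right) (auto simp: act_closed simp flip: power_mult_distrib)
  finally have "B (word_act g w x) x = - B x (word_act g w x)" .
  then show ?thesis using form_sym [of x "word_act g w x"] assms act_closed by auto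
qed

lemma comm_word:
  assumes "comm_sign s w u = r" "r \<noteq> 0" "set w \<subseteq> set L" "set u \<subseteq> set L" "x \<in> U"
  shows "word_act g w (word_act g u x) = of_int r *\<^sub>R word_act g u (word_act g w x)"
  using act_ratio(1) [of "w @ u" "u @ w" r x] assms by (simp add: comm_sign_def)

text \<open>Equal letters meet in the middle and collapse one pair after the other. Thus every word
  acts invertibly, with its reversal as inverse up to a sign that is the same for all
  vectors.\<close>

lemma act_rev:
  "set w \<subseteq> set L \<Longrightarrow> \<exists>c. (c = 1 \<or> c = - 1) \<and> (\<forall>x\<in>U. word_act g (rev w) (word_act g w x) = c *\<^sub>R x)"
proof (induction w)
  case Nil
  then show ?case by (intro exI [of _ 1]) auto
next
  case (Cons i w)
  then obtain c where c: "c = 1 \<or> c = - 1"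
    "\<And>x. x \<in> U \<Longrightarrow> word_act g (rev w) (word_act g w x) = c *\<^sub>R x" by auto
  have "word_act g (rev (i # w)) (word_act g (i # w) x) = (of_int (s i) * c) *\<^sub>R x" if "x \<in> U" for x
    using Cons.prems that c(2) [OF that] by (simp add: gen_square act_closed act_scale)
  then show ?case using sign [of i] c by (intro exI [of _ "of_int (s i) * c"]) auto
qed

end

section \<open>Common eigenvectors of involutions and rotation by complex structures\<close>

fun fresh_last :: "nat list list \<Rightarrow> bool" where
  "fresh_last [] = True"
| "fresh_last (P # Ps) \<longleftrightarrow>
    P \<noteq> [] \<and> last P \<notin> set (butlast P) \<and> (\<forall>Q\<in>set Ps. last P \<notin> set Q) \<and> fresh_last Ps"

text \<open>
  The words in \<open>Ps\<close> act as commuting symmetric involutions, whose common eigenspaces are mapped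
  to themselves by the words in \<open>Ns\<close>, which act as anticommuting symmetric complex structures.
\<close>

definition good_words :: "(nat \<Rightarrow> int) \<Rightarrow> nat list \<Rightarrow> nat list list \<Rightarrow> nat list list \<Rightarrow> bool" where
  "good_words s L Ps Ns \<longleftrightarrow>
    fresh_last Ps \<and>
    (\<forall>P\<in>set Ps. set P \<subseteq> set L \<and> clif_ratio s (P @ P) [] = 1 \<and> sym_word s P \<and>
       (\<forall>Q\<in>set Ps. comm_sign s P Q = 1)) \<and>
    (\<forall>N\<in>set Ns. set N \<subseteq> set L \<and> clif_ratio s (N @ N) [] = - 1 \<and> sym_word s N \<and>
       (\<forall>P\<in>set Ps. comm_sign s N P = 1) \<and> (\<forall>N'\<in>set Ns. N' = N \<or> comm_sign s N' N = - 1))"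

lemma prod_list_map_upd:
  "i \<notin> set P \<Longrightarrow> prod_list (map (f(i := c)) P) = prod_list (map f P)"
  by (induction P) auto

text \<open>The system for the signs is triangular: the last letter of a word occurs once in that
  word and in no later word. Once the later words are settled, flipping the sign of this letter
  corrects the current word and disturbs none of them.\<close>

lemma fresh_last_signs:
  fixes e :: "nat list \<Rightarrow> real"
  assumes "fresh_last Ps" and "\<And>P. e P = 1 \<or> e P = - 1"
  shows "\<exists>\<sigma> :: nat \<Rightarrow> real. (\<forall>i. \<sigma> i = 1 \<or> \<sigma> i = - 1) \<and> (\<forall>P\<in>set Ps. prod_list (map \<sigma> P) = e P)"
  using assms(1)
proof (induction Ps)
  case Nil
  then show ?case by (intro exI [of _ "\<lambda>_. 1"]) auto
next
  case (Cons P Ps)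
  then obtain \<sigma> :: "nat \<Rightarrow> real" where \<sigma>: "\<And>i. \<sigma> i = 1 \<or> \<sigma> i = - 1"
    "\<And>P. P \<in> set Ps \<Longrightarrow> prod_list (map \<sigma> P) = e P" by auto
  define i where "i = last P"
  have P: "P = butlast P @ [i]" and i: "i \<notin> set (butlast P)" "\<And>Q. Q \<in> set Ps \<Longrightarrow> i \<notin> set Q"
    using Cons.prems by (auto simp: i_def)
  define c where "c = e P * prod_list (map \<sigma> (butlast P))"
  have sg: "prod_list (map \<sigma> Q) = 1 \<or> prod_list (map \<sigma> Q) = - 1" for Q
  proof (induction Q)
    case (Cons j Q)
    then show ?case using \<sigma>(1) [of j] by auto
  qed simp
  have c: "c = 1 \<or> c = - 1" using sg [of "butlast P"] assms(2) [of P] by (auto simp: c_def)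
  have "prod_list (map (\<sigma>(i := c)) P) = prod_list (map \<sigma> (butlast P)) * c"
    by (subst P) (simp add: prod_list_map_upd [OF i(1)])
  also have "\<dots> = e P" using sg [of "butlast P"] by (auto simp: c_def)
  finally have "prod_list (map (\<sigma>(i := c)) P) = e P" .
  moreover have "prod_list (map (\<sigma>(i := c)) Q) = e Q" if "Q \<in> set Ps" for Q
    using \<sigma>(2) [OF that] prod_list_map_upd [OF i(2) [OF that], of \<sigma> c] by simp
  moreover have "(\<sigma>(i := c)) j = 1 \<or> (\<sigma>(i := c)) j = - 1" for j
    using \<sigma>(1) [of j] c by simp
  ultimately show ?case by (metis set_ConsD)
qed

context clifford_family
begin

lemma nonisotropic_vector:
  assumes "U \<noteq> {0}"
  shows "\<exists>v\<in>U. B v v \<noteq> 0"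
proof (rule ccontr)
  assume "\<not> ?thesis"
  then have z: "B v v = 0" if "v \<in> U" for v using that by blast
  have "B x y = 0" if "x \<in> U" "y \<in> U" for x y
  proof -
    have "B (x + y) (x + y) = B x x + B x y + (B y x + B y y)"
      using that by (simp add: form_simps in_U)
    then show ?thesis using z that form_sym [OF that] in_U(1) [OF that] by simp
  qed
  then have "U = {0}" using form_nondegenerate in_U(5) by blast
  with assms show False by simp
qed

text \<open>Induction on the list: \<open>v\<close> is replaced by its projection, up to scale, to
  an eigenspace of the new involution. The words commute, so the projection remains an eigenvector
  of the earlier ones.\<close>

lemma common_eigenvector:
  assumes "U \<noteq> {0}"
    and Ps: "\<And>P. P \<in> set Ps \<Longrightarrow> set P \<subseteq> set L \<and> clif_ratio s (P @ P) [] = 1 \<and> sym_word s P"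
      "\<And>P Q. P \<in> set Ps \<Longrightarrow> Q \<in> set Ps \<Longrightarrow> comm_sign s P Q = 1"
  shows "\<exists>v\<in>U. B v v \<noteq> 0 \<and> (\<forall>P\<in>set Ps. word_act g P v = v \<or> word_act g P v = - v)"
  using Ps
proof (induction Ps)
  case Nil
  then show ?case using nonisotropic_vector [OF assms(1)] by simp
next
  case (Cons P Ps)
  obtain v where v: "v \<in> U" "B v v \<noteq> 0"
    "\<And>Q. Q \<in> set Ps \<Longrightarrow> word_act g Q v = v \<or> word_act g Q v = - v"
    using Cons by (metis list.set_intros(2))
  define p where "p = word_act g P v"
  have PL: "set P \<subseteq> set L" and P: "clif_ratio s (P @ P) [] = 1" "sym_word s P"
    using Cons.prems(1) [of P] by auto
  have p: "p \<in> U" using v PL by (simp add: p_def act_closed)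
  have pp: "word_act g P p = v"
    using act_ratio(1) [OF P(1), of v] PL v by (simp add: p_def)
  have Bpp: "B p p = B v v"
    using sym_word [OF P(2) PL v(1) p] pp by (simp add: p_def)
  have Q: "word_act g Q p = p \<and> word_act g Q v = v \<or> word_act g Q p = - p \<and> word_act g Q v = - v"
    if "Q \<in> set Ps" for Q
  proof -
    have QL: "set Q \<subseteq> set L" using Cons.prems(1) [of Q] that by auto
    have "word_act g Q p = word_act g P (word_act g Q v)"
      using comm_word [of Q P 1 v] Cons.prems(2) [of Q P] that QL PL v by (simp add: p_def)
    then show ?thesis using v(3) [OF that] act_minus [OF PL v(1)] by (auto simp: p_def)
  qed
  \<comment> \<open>The involution preserves \<open>B\<close>, so the values of the quadratic form
    at \<open>v + p\<close> and \<open>v - p\<close> add up to \<open>4 * B v v\<close>, which is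
    not zero.\<close>
  have "\<exists>c. (c = 1 \<or> c = - 1) \<and> B (v + c *\<^sub>R p) (v + c *\<^sub>R p) \<noteq> 0"
  proof (rule ccontr)
    assume "\<not> ?thesis"
    then have "B (v + 1 *\<^sub>R p) (v + 1 *\<^sub>R p) = 0" "B (v + (- 1) *\<^sub>R p) (v + (- 1) *\<^sub>R p) = 0"
      by blast+
    then show False using v p Bpp by (simp add: form_simps in_U del: scaleR_minus1_left scaleR_minus_left scaleR_one)
  qed
  then obtain c where c: "c = 1 \<or> c = - 1" and nz: "B (v + c *\<^sub>R p) (v + c *\<^sub>R p) \<noteq> 0" by blast
  define u where "u = v + c *\<^sub>R p"
  have uU: "u \<in> U" using v p by (simp add: u_def in_U)
  have "word_act g P u = c *\<^sub>R u"
    using v p c pp by (auto simp: u_def act_add [OF PL] act_scale [OF PL] act_minus [OF PL] in_U p_def [symmetric])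
  then have uP: "word_act g P u = u \<or> word_act g P u = - u" using c by auto
  have "word_act g Q u = u \<or> word_act g Q u = - u" if "Q \<in> set Ps" for Q
  proof -
    have QL: "set Q \<subseteq> set L" using Cons.prems(1) [of Q] that by auto
    then have "word_act g Q u = word_act g Q v + c *\<^sub>R word_act g Q p"
      using v p by (simp add: u_def act_add act_scale in_U)
    then show ?thesis using Q [OF that] by (auto simp: u_def)
  qed
  then show ?case using uU nz uP by (intro bexI [of _ u]) (auto simp: u_def)
qed

text \<open>
  With the complex structure \<open>N\<close>, the numbers \<open>B v v\<close> and \<open>B (N v) v\<close> are the real and imaginary
  part of a complex quadratic form, and a scalar \<open>a + bN\<close> turns its value real.
\<close>

lemma complex_rotation:
  assumes N: "set N \<subseteq> set L" "clif_ratio s (N @ N) [] = - 1" "sym_word s N"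
    and v: "v \<in> U" "B v v \<noteq> 0"
  shows "\<exists>a b. let u = a *\<^sub>R v + b *\<^sub>R word_act g N v in B u u \<noteq> 0 \<and> B (word_act g N u) u = 0"
proof (cases "B (word_act g N v) v = 0")
  case True
  then show ?thesis using v by (intro exI [of _ 1] exI [of _ 0]) (simp add: Let_def)
next
  case False
  define n z y where "n = word_act g N v" and "z = B v v" and "y = B n v"
  define r where "r = sqrt (z\<^sup>2 + y\<^sup>2)"
  \<comment> \<open>With \<open>N\<close> in the role of the imaginary unit i, the scalar
    \<open>a + i y\<close> is a square root of \<open>z + i y\<close> up to a real factor: its
    square is \<open>2 a (z + i y)\<close>. Since the quadratic form takes the value
    \<open>z - i y\<close> at \<open>v\<close>, it takes the real value \<open>2 a r r\<close> at
    \<open>u\<close>.\<close>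
  define a where "a = z + r"
  have n: "n \<in> U" using v N by (simp add: n_def act_closed)
  have nn: "word_act g N n = - v"
    using act_ratio(1) [OF N(2), of v] N v by (simp add: n_def)
  have Bnn: "B n n = - z"
    using sym_word [OF N(3) N(1) v(1) n] nn v by (simp add: n_def z_def form_simps)
  have Bvn: "B v n = y" using form_sym v n by (simp add: y_def)
  have y: "y \<noteq> 0" using False by (simp add: y_def n_def)
  have r2: "r * r = z * z + y * y" by (simp add: r_def power2_eq_square)
  have "\<bar>z\<bar> < r" using y by (auto simp: r_def intro!: real_less_rsqrt)
  then have "a \<noteq> 0" by (auto simp: a_def)
  have "r \<noteq> 0" using \<open>\<bar>z\<bar> < r\<close> by auto
  define u where "u = a *\<^sub>R v + y *\<^sub>R n"
  have Nu: "word_act g N u = a *\<^sub>R n - y *\<^sub>R v"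
    using v n N nn by (simp add: u_def act_add act_scale in_U n_def [symmetric])
  have "B u u = a * a * z + 2 * a * y * y - y * y * z"
    using v n Bnn Bvn by (simp add: u_def form_simps in_U z_def [symmetric] y_def [symmetric] algebra_simps)
  also have "\<dots> = 2 * a * (r * r)"
    using r2 by (simp add: a_def algebra_simps)
  finally have "B u u \<noteq> 0" using \<open>a \<noteq> 0\<close> \<open>r \<noteq> 0\<close> by simp
  moreover have "B (word_act g N u) u = a * a * y - 2 * a * y * z - y * y * y"
  proof -
    have "B (a *\<^sub>R n + (- y) *\<^sub>R v) (a *\<^sub>R v + y *\<^sub>R n) = a * a * y - 2 * a * y * z - y * y * y"
      using v n Bnn Bvn
      by (simp add: form_simps in_U z_def [symmetric] y_def [symmetric] algebra_simps del: scaleR_minus_left)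
    then show ?thesis unfolding Nu unfolding u_def by simp
  qed
  then have "B (word_act g N u) u = y * (r * r - z * z - y * y)"
    by (simp add: a_def algebra_simps)
  then have "B (word_act g N u) u = 0" using r2 by simp
  ultimately show ?thesis
    by (intro exI [of _ a] exI [of _ y]) (simp add: Let_def u_def n_def)
qed

text \<open>The rotations are carried out one after the other. Each commutes with the words in
  \<open>Ps\<close>, so the eigenvalues survive, and anticommutation keeps the zeros already
  obtained for the other complex structures.\<close>

lemma good_vector:
  assumes nz: "U \<noteq> {0}" and good: "good_words s L Ps Ns"
  shows "\<exists>v\<in>U. B v v \<noteq> 0 \<and> (\<forall>P\<in>set Ps. word_act g P v = v \<or> word_act g P v = - v) \<and>
      (\<forall>N\<in>set Ns. B (word_act g N v) v = 0)"
proof -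
  have "set Ms \<subseteq> set Ns \<Longrightarrow> \<exists>v\<in>U. B v v \<noteq> 0 \<and>
      (\<forall>P\<in>set Ps. word_act g P v = v \<or> word_act g P v = - v) \<and>
      (\<forall>N\<in>set Ms. B (word_act g N v) v = 0)" for Ms
  proof (induction Ms)
    case Nil
    then show ?case using common_eigenvector [OF nz, of Ps] good by (simp add: good_words_def)
  next
    case (Cons N Ms)
    then obtain v where v: "v \<in> U" "B v v \<noteq> 0"
      "\<And>P. P \<in> set Ps \<Longrightarrow> word_act g P v = v \<or> word_act g P v = - v"
      "\<And>N. N \<in> set Ms \<Longrightarrow> B (word_act g N v) v = 0" by auto
    have N: "set N \<subseteq> set L" "clif_ratio s (N @ N) [] = - 1" "sym_word s N"
      using Cons.prems good by (auto simp: good_words_def)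
    show ?case
    proof (cases "N \<in> set Ms")
      case True
      then show ?thesis using v by auto
    next
      case False
      obtain a b where ab: "let u = a *\<^sub>R v + b *\<^sub>R word_act g N v in B u u \<noteq> 0 \<and> B (word_act g N u) u = 0"
        using complex_rotation [OF N v(1,2)] by blast
      define n where "n = word_act g N v"
      define u where "u = a *\<^sub>R v + b *\<^sub>R n"
      have n: "n \<in> U" using v N by (simp add: n_def act_closed)
      have u: "u \<in> U" using v n by (simp add: u_def in_U)
      have nn: "word_act g N n = - v"
        using act_ratio(1) [OF N(2), of v] N v by (simp add: n_def)
      have "word_act g P u = u \<or> word_act g P u = - u" if "P \<in> set Ps" for P
      proof -
        have PL: "set P \<subseteq> set L" and NP: "comm_sign s N P = 1"
          using good that Cons.prems by (auto simp: good_words_def)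
        have "word_act g P n = word_act g N (word_act g P v)"
          using comm_word [of N P 1 v] NP N PL v by (simp add: n_def)
        then have "word_act g P v = v \<and> word_act g P n = n \<or> word_act g P v = - v \<and> word_act g P n = - n"
          using v(3) [OF that] act_minus [OF N(1) v(1)] by (auto simp: n_def)
        moreover have "word_act g P u = a *\<^sub>R word_act g P v + b *\<^sub>R word_act g P n"
          using v n PL by (simp add: u_def act_add act_scale in_U)
        ultimately show ?thesis by (auto simp: u_def)
      qed
      moreover have "B (word_act g M u) u = 0" if "M \<in> set Ms" for M
      proof -
        have "M \<noteq> N" "M \<in> set Ns" "N \<in> set Ns" using that False Cons.prems by auto
        have M: "set M \<subseteq> set L" "sym_word s M" and MN: "comm_sign s M N = - 1"
          using \<open>M \<in> set Ns\<close> \<open>N \<in> set Ns\<close> good \<open>M \<noteq> N\<close> unfolding good_words_def by blast+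
        define m where "m = word_act g M v"
        have m: "m \<in> U" using v M by (simp add: m_def act_closed)
        have Nm: "word_act g N m \<in> U" using m N by (simp add: act_closed)
        have Mn: "word_act g M n = - word_act g N m"
          using comm_word [OF MN, of v] M N v by (simp add: m_def n_def)
        have "B m v = 0" using v(4) [OF that] by (simp add: m_def)
        \<comment> \<open>In the expansion of \<open>B (M u) u\<close> the two mixed terms have
          coefficients \<open>a b\<close> and \<open>- a b\<close> and cancel by this symmetry; the
          pure terms are multiples of \<open>B m v = 0\<close>.\<close>
        have 1: "B (word_act g N m) v = B m n"
          using sym_word [OF N(3) N(1) m v(1)] by (simp add: n_def)
        have 2: "B (word_act g N m) n = 0"
          using sym_word [OF N(3) N(1) m n] nn v m \<open>B m v = 0\<close> by (simp add: form_simps)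
        have "word_act g M u = a *\<^sub>R m + (- b) *\<^sub>R word_act g N m"
          using v n M Mn by (simp add: u_def act_add act_scale in_U m_def [symmetric])
        then show ?thesis
          using v n m Nm 1 2 \<open>B m v = 0\<close>
          by (simp add: u_def form_simps in_U del: scaleR_minus_left)
      qed
      ultimately show ?thesis
        using ab u by (intro bexI [of _ u]) (auto simp: u_def n_def Let_def)
    qed
  qed
  then show ?thesis by blast
qed

end

section \<open>Values of words on adapted vectors\<close>

fun first_nonzero :: "int list \<Rightarrow> int" where
  "first_nonzero [] = 0"
| "first_nonzero (x # xs) = (if x \<noteq> 0 then x else first_nonzero xs)"

text \<open>
  The coefficient of \<open>w v\<close> along \<open>v\<close> for a vector \<open>v\<close> that is fixed by the words in \<open>Ps\<close>.
\<close>

definition word_value :: "(nat \<Rightarrow> int) \<Rightarrow> nat list list \<Rightarrow> nat list \<Rightarrow> int" where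
  "word_value s Ps w = (case clif_norm s w of (c, M) \<Rightarrow>
     c * first_nonzero (map (\<lambda>Q. clif_ratio s (M @ Q) []) (map concat (subseqs Ps))))"

text \<open>
  This determines \<open>B (w v) v\<close> for all words \<open>w\<close>. The conditionals instead of disjunctions make
  \<open>code_simp\<close> evaluate lazily.
\<close>

definition complete_words :: "(nat \<Rightarrow> int) \<Rightarrow> nat list \<Rightarrow> nat list list \<Rightarrow> nat list list \<Rightarrow> bool" where
  "complete_words s L Ps Ns \<longleftrightarrow>
    (\<forall>M\<in>set (subseqs L).
      if skew_word s M then True
      else if \<exists>P\<in>set Ps. comm_sign s M P = - 1 then True
      else \<exists>Q\<in>set (map concat (subseqs Ps)).
        clif_ratio s (M @ Q) [] \<noteq> 0 \<or> (\<exists>N\<in>set Ns. clif_ratio s (M @ Q) N \<noteq> 0))"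

lemma first_nonzero_cases:
  "first_nonzero xs = 0 \<and> (\<forall>x\<in>set xs. x = 0) \<or> first_nonzero xs \<noteq> 0 \<and> first_nonzero xs \<in> set xs"
  by (induction xs) auto

context clifford_family
begin

lemma form_sum:
  assumes "finite Y" "Y \<subseteq> U" "b \<in> U"
  shows "(\<Sum>a\<in>Y. f a *\<^sub>R a) \<in> U \<and> B (\<Sum>a\<in>Y. f a *\<^sub>R a) b = (\<Sum>a\<in>Y. f a * B a b)"
  using assms(1,2)
proof (induction Y rule: finite_induct)
  case empty
  then show ?case using form_left(2) [OF assms(3) in_U(5), of 0] by (simp add: in_U)
next
  case (insert a Y)
  then show ?case using assms(3) by (simp add: in_U form_simps)
qed

text \<open>Discarding every vector proportional to one already chosen leaves a pairwise orthogonal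
  set \<open>Y\<close> with the same span. Its members are not isotropic, so pairing with them
  recovers all coefficients of \<open>x\<close>.\<close>

lemma span_nondegenerate:
  assumes X: "finite X" "X \<subseteq> U" "\<And>x. x \<in> X \<Longrightarrow> B x x \<noteq> 0"
    and orth: "\<And>x y. x \<in> X \<Longrightarrow> y \<in> X \<Longrightarrow> B x y = 0 \<or> (\<exists>c. x = c *\<^sub>R y)"
    and x: "x \<in> span X" "\<And>y. y \<in> X \<Longrightarrow> B x y = 0"
  shows "x = 0"
proof -
  have "\<exists>Y\<subseteq>Z. Z \<subseteq> span Y \<and> (\<forall>x\<in>Y. \<forall>y\<in>Y. x \<noteq> y \<longrightarrow> B x y = 0)" if "finite Z" "Z \<subseteq> X" for Z
    using that
  proof (induction Z rule: finite_induct)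
    case (insert a Z)
    then obtain Y where Y: "Y \<subseteq> Z" "Z \<subseteq> span Y" "\<forall>x\<in>Y. \<forall>y\<in>Y. x \<noteq> y \<longrightarrow> B x y = 0" by auto
    show ?case
    proof (cases "\<exists>y\<in>Y. B a y \<noteq> 0")
      case True
      then obtain y where y: "y \<in> Y" "B a y \<noteq> 0" by blast
      then obtain c where "a = c *\<^sub>R y" using orth [of a y] insert.prems Y(1) by auto
      then have "a \<in> span Y" using y by (simp add: span_base span_scale)
      then show ?thesis using Y by (intro exI [of _ Y]) auto
    next
      case False
      then have "B y a = 0" if "y \<in> Y" for y
        using form_sym [of a y] that Y(1) insert.prems X(2) by auto
      moreover have "insert a Z \<subseteq> span (insert a Y)"
        using Y(2) span_mono [of Y "insert a Y"] by (auto simp: span_base)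
      ultimately show ?thesis using Y False by (intro exI [of _ "insert a Y"]) auto
    qed
  qed simp
  from this [OF X(1) order_refl] obtain Y where
    Y: "Y \<subseteq> X" "X \<subseteq> span Y" and "\<forall>x\<in>Y. \<forall>y\<in>Y. x \<noteq> y \<longrightarrow> B x y = 0"
    by (elim exE conjE)
  then have ortho: "B x y = 0" if "x \<in> Y" "y \<in> Y" "x \<noteq> y" for x y using that by simp
  have fin: "finite Y" using Y(1) X(1) finite_subset by blast
  have "x \<in> span Y" using x(1) Y(2) span_minimal [OF Y(2) subspace_span] by auto
  then obtain f where f: "x = (\<Sum>a\<in>Y. f a *\<^sub>R a)" using span_finite [OF fin] by auto
  have "f b = 0" if "b \<in> Y" for b
  proof -
    have "B x b = (\<Sum>a\<in>Y. f a * B a b)"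
      unfolding f using form_sum [OF fin, of b f] Y(1) X(2) that by auto
    also have "\<dots> = (\<Sum>a\<in>Y. if a = b then f b * B b b else 0)"
      using ortho that by (intro sum.cong) auto
    also have "\<dots> = f b * B b b" using fin that by simp
    finally show ?thesis using x(2) X(3) Y(1) that by auto
  qed
  then show ?thesis using f by simp
qed

text \<open>The eigenvalues are normalised to 1, which is achieved by changing the signs of
  generators; word values then depend only on the combinatorial data.\<close>

definition adapted_vector :: "nat list list \<Rightarrow> nat list list \<Rightarrow> 'u \<Rightarrow> bool" where
  "adapted_vector Ps Ns v \<longleftrightarrow> v \<in> U \<and> B v v \<noteq> 0 \<and> (\<forall>P\<in>set Ps. word_act g P v = v) \<and>
    (\<forall>N\<in>set Ns. B (word_act g N v) v = 0)"

text \<open>Products \<open>Q\<close> of words in \<open>Ps\<close> fix \<open>v\<close>. If the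
  normal form \<open>M\<close> times some \<open>Q\<close> is a scalar, then \<open>M v\<close> is
  \<open>v\<close> up to sign. Otherwise \<open>M\<close> is skew, or anticommutes with a symmetric
  \<open>P\<close> fixing \<open>v\<close>, or agrees on \<open>v\<close> up to sign with some
  \<open>N\<close> from \<open>Ns\<close>; each of these gives \<open>B (M v) v = 0\<close>.\<close>

lemma act_word_value:
  assumes v: "adapted_vector Ps Ns v" and good: "good_words s L Ps Ns"
    and compl: "complete_words s L Ps Ns" and w: "set w \<subseteq> set L"
  shows "word_value s Ps w = 0 \<and> B (word_act g w v) v = 0 \<or>
    \<bar>word_value s Ps w\<bar> = 1 \<and> word_act g w v = of_int (word_value s Ps w) *\<^sub>R v"
proof -
  have vU: "v \<in> U" using v by (simp add: adapted_vector_def)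
  obtain c M where M: "clif_norm s w = (c, M)" by fastforce
  define r where "r = first_nonzero (map (\<lambda>Q. clif_ratio s (M @ Q) []) (map concat (subseqs Ps)))"
  have val: "word_value s Ps w = c * r" by (simp add: word_value_def M r_def)
  have c: "c = 1 \<or> c = - 1" using clif_norm_sign [OF M] sign by blast
  have sub_M: "M \<in> set (subseqs L)" "set M \<subseteq> set L"
    using norm_in_subseqs [OF M w] subseqs_subset by auto
  have w_M: "word_act g w v = of_int c *\<^sub>R word_act g M v"
    using act_norm [OF vU M w] by simp
  have MU: "word_act g M v \<in> U" using sub_M vU by (simp add: act_closed)
  have P: "set P \<subseteq> set L" "sym_word s P" "word_act g P v = v" if "P \<in> set Ps" for P
    using that v good by (auto simp: adapted_vector_def good_words_def)
  have Q: "set Q \<subseteq> set L \<and> word_act g Q v = v" if Q: "Q \<in> set (map concat (subseqs Ps))" for Q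
  proof -
    obtain Rs where Rs: "Q = concat Rs" "\<And>P. P \<in> set Rs \<Longrightarrow> set P \<subseteq> set L \<and> word_act g P v = v"
      using set_concat_subseqs [OF Q, of "\<lambda>P. set P \<subseteq> set L \<and> word_act g P v = v"] P by blast
    have "set (concat Rs) \<subseteq> set L \<and> word_act g (concat Rs) v = v"
      using Rs(2) by (induction Rs) auto
    then show ?thesis using Rs(1) by simp
  qed
  show ?thesis
  proof (cases "r = 0")
    case False
    then obtain Q where Q': "Q \<in> set (map concat (subseqs Ps))" "clif_ratio s (M @ Q) [] = r"
      using first_nonzero_cases [of "map (\<lambda>Q. clif_ratio s (M @ Q) []) (map concat (subseqs Ps))"]
      unfolding r_def by (metis (no_types, lifting) imageE list.set_map)
    have "word_act g M v = of_int r *\<^sub>R v" "r = 1 \<or> r = - 1"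
      using act_ratio [OF Q'(2) False _ _ vU] Q [OF Q'(1)] sub_M by auto
    then show ?thesis using val c w_M by auto
  next
    case True
    then have r0: "clif_ratio s (M @ Q) [] = 0" if "Q \<in> set (map concat (subseqs Ps))" for Q
      using first_nonzero_cases [of "map (\<lambda>Q. clif_ratio s (M @ Q) []) (map concat (subseqs Ps))"]
        that unfolding r_def by auto
    consider "skew_word s M" | P where "P \<in> set Ps" "comm_sign s M P = - 1"
      | Q N where "Q \<in> set (map concat (subseqs Ps))" "N \<in> set Ns" "clif_ratio s (M @ Q) N \<noteq> 0"
    proof -
      have "if skew_word s M then True
        else if \<exists>P\<in>set Ps. comm_sign s M P = - 1 then True
        else \<exists>Q\<in>set (map concat (subseqs Ps)).
          clif_ratio s (M @ Q) [] \<noteq> 0 \<or> (\<exists>N\<in>set Ns. clif_ratio s (M @ Q) N \<noteq> 0)"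
        using compl sub_M(1) unfolding complete_words_def by (rule bspec)
      then show thesis using that r0 by (metis (no_types, lifting))
    qed
    then have "B (word_act g M v) v = 0"
    proof cases
      case 1
      then show ?thesis using skew_word sub_M vU by blast
    next
      case 2
      have "word_act g M v = - word_act g P (word_act g M v)"
        using comm_word [OF 2(2), of v] P [OF 2(1)] sub_M vU by simp
      then have "B (word_act g M v) v = - B (word_act g P (word_act g M v)) v"
        using form_minus(2) [OF vU, of "word_act g P (word_act g M v)"] MU P(1) [OF 2(1)]
        by (simp add: act_closed)
      also have "\<dots> = - B (word_act g M v) v"
        using sym_word [OF P(2) [OF 2(1)] P(1) [OF 2(1)] MU vU] P(3) [OF 2(1)] by simp
      finally show ?thesis by simp
    next
      case 3
      have N: "set N \<subseteq> set L" "B (word_act g N v) v = 0"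
        using v good 3(2) by (auto simp: adapted_vector_def good_words_def)
      have "word_act g M v = of_int (clif_ratio s (M @ Q) N) *\<^sub>R word_act g N v"
        using act_ratio(1) [OF refl 3(3) _ N(1) vU] Q [OF 3(1)] sub_M by simp
      then show ?thesis using N vU by (simp add: form_simps act_closed)
    qed
    then show ?thesis using val True w_M c MU vU by (auto simp: form_simps)
  qed
qed

end

section \<open>Minimal families and cyclicity of adapted vectors\<close>

locale minimal_clifford_family = clifford_family +
  assumes nontrivial: "U \<noteq> {0}"
    and minimal: "finite X \<Longrightarrow> X \<subseteq> U \<Longrightarrow> span X \<noteq> {0} \<Longrightarrow>
      (\<And>i x. i \<in> set L \<Longrightarrow> x \<in> X \<Longrightarrow> g i x \<in> span X) \<Longrightarrow>
      (\<And>x. x \<in> span X \<Longrightarrow> (\<And>y. y \<in> X \<Longrightarrow> B x y = 0) \<Longrightarrow> x = 0) \<Longrightarrow> span X = U"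
begin

text \<open>The finite orbit \<open>X\<close> consists of nonisotropic vectors, any two of them
  orthogonal or proportional. Hence its span is nondegenerate as well as invariant, and minimality
  leaves no room for a proper subspace.\<close>

lemma adapted_vector_cyclic:
  assumes v: "adapted_vector Ps Ns v" and good: "good_words s L Ps Ns"
    and compl: "complete_words s L Ps Ns"
  shows "U = span ((\<lambda>w. word_act g w v) ` {w. set w \<subseteq> set L})" (is "U = span ?S")
proof -
  have vU: "v \<in> U" and Bv: "B v v \<noteq> 0" using v by (simp_all add: adapted_vector_def)
  define X where "X = (\<lambda>M. word_act g M v) ` set (subseqs L)"
  have XU: "X \<subseteq> U" using subseqs_subset vU by (auto simp: X_def act_closed)
  have in_span: "word_act g w v \<in> span X" if "set w \<subseteq> set L" for w
  proof -
    obtain c M where M: "clif_norm s w = (c, M)" by fastforce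
    have "word_act g M v \<in> X" using norm_in_subseqs [OF M that] by (simp add: X_def)
    then show ?thesis using act_norm [OF vU M that] by (simp add: span_base span_scale)
  qed
  \<comment> \<open>The clause \<open>x \<noteq> y\<close> excludes the first alternative for
    \<open>x = y\<close>, so the same fact also yields that every member of \<open>X\<close> is
    nonisotropic.\<close>
  have pair: "\<exists>r. (B x y = 0 \<and> x \<noteq> y) \<or> (x = r *\<^sub>R y \<and> B x x \<noteq> 0)" if xy: "x \<in> X" "y \<in> X" for x y
  proof -
    obtain M M' where M: "M \<in> set (subseqs L)" "x = word_act g M v"
      and M': "M' \<in> set (subseqs L)" "y = word_act g M' v"
      using xy by (auto simp: X_def)
    have sub_M: "set M \<subseteq> set L" "set M' \<subseteq> set L" using M M' subseqs_subset by auto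
    have xU: "x \<in> U" and yU: "y \<in> U" using xy XU by auto
    \<comment> \<open>A word preserves the quadratic form up to sign, by the adjoint formula and the
      collapse of \<open>rev K\<close> against \<open>K\<close>.\<close>
    have nz: "B (word_act g K v) (word_act g K v) \<noteq> 0" if K: "set K \<subseteq> set L" for K
    proof -
      obtain c where c: "c = 1 \<or> c = - 1" "word_act g (rev K) (word_act g K v) = c *\<^sub>R v"
        using act_rev [OF K] vU by blast
      have "B v (word_act g (rev K) (word_act g K v)) = (c :: real) * B v v"
        using vU c by (simp add: form_simps)
      then show ?thesis using c Bv K vU by (auto simp: act_adjoint act_closed)
    qed
    have BxY: "B y x = (- 1) ^ length M' * B v (word_act g (rev M' @ M) v)"
      using act_adjoint [OF sub_M(2) vU xU] M M' by simp
    have "set (rev M' @ M) \<subseteq> set L" using sub_M by auto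
    from act_word_value [OF v good compl this] show ?thesis
    proof
      assume "word_value s Ps (rev M' @ M) = 0 \<and> B (word_act g (rev M' @ M) v) v = 0"
      then have "B x y = 0"
        using BxY form_sym [of x y] form_sym [of v "word_act g (rev M' @ M) v"] xU yU vU sub_M
        by (simp add: act_closed)
      then show ?thesis using nz [OF sub_M(1)] M by auto
    next
      assume "\<bar>word_value s Ps (rev M' @ M)\<bar> = 1 \<and>
        word_act g (rev M' @ M) v = of_int (word_value s Ps (rev M' @ M)) *\<^sub>R v"
      then obtain r :: real where r: "word_act g (rev M') x = r *\<^sub>R v" using M by auto
      obtain c where c: "c = 1 \<or> c = - 1" "word_act g (rev (rev M')) (word_act g (rev M') x) = c *\<^sub>R x"
        using act_rev [of "rev M'"] sub_M xU by auto
      have "c *\<^sub>R x = r *\<^sub>R y" using c(2) r M' sub_M vU by (simp add: act_scale)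
      moreover have "x = c *\<^sub>R (c *\<^sub>R x)" using c(1) by auto
      ultimately have "x = (c * r) *\<^sub>R y" by simp
      then show ?thesis using nz [OF sub_M(1)] M by auto
    qed
  qed
  have "span X = U"
  proof (rule minimal)
    show "finite X" by (simp add: X_def)
    show "X \<subseteq> U" by (rule XU)
    have "v \<in> span X" using in_span [of "[]"] by simp
    moreover have "v \<noteq> 0" using Bv form_left(2) [OF vU vU, of 0] by auto
    ultimately show "span X \<noteq> {0}" by blast
    show "g i x \<in> span X" if i: "i \<in> set L" "x \<in> X" for i x
    proof -
      obtain M where "M \<in> set (subseqs L)" "x = word_act g M v" using i by (auto simp: X_def)
      then show ?thesis using in_span [of "i # M"] subseqs_subset [of M] i by simp
    qed
    show "x = 0" if "x \<in> span X" "\<And>y. y \<in> X \<Longrightarrow> B x y = 0" for x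
    proof (rule span_nondegenerate [OF _ XU _ _ that])
      show "finite X" by (simp add: X_def)
      show "B x x \<noteq> 0" if "x \<in> X" for x using pair [OF that that] by blast
      show "B x y = 0 \<or> (\<exists>c. x = c *\<^sub>R y)" if "x \<in> X" "y \<in> X" for x y
        using pair [OF that] by blast
    qed
  qed
  moreover have "span X \<subseteq> span ?S"
    using subseqs_subset by (intro span_mono) (auto simp: X_def)
  moreover have "span ?S \<subseteq> span X"
    using in_span by (intro span_minimal) auto
  ultimately show ?thesis by simp
qed

lemma sign_change:
  assumes \<sigma>: "\<And>i. \<sigma> i = 1 \<or> \<sigma> i = (- 1 :: real)"
  shows "minimal_clifford_family U B (\<lambda>i x. \<sigma> i *\<^sub>R g i x) s L"
proof
  fix i x y assume i: "i \<in> set L" and x: "x \<in> U"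
  show "\<sigma> i *\<^sub>R g i (\<sigma> i *\<^sub>R g i x) = of_int (s i) *\<^sub>R x"
    using \<sigma> [of i] i x gen_scale [OF i gen_closed [OF i x], of "- 1"] by (auto simp: gen_square)
  show "B (\<sigma> i *\<^sub>R g i x) y = - B x (\<sigma> i *\<^sub>R g i y)" if "y \<in> U"
    using i x that by (simp add: form_simps gen_closed gen_skew)
  show "\<sigma> i *\<^sub>R g i (\<sigma> j *\<^sub>R g j x) = - (\<sigma> j *\<^sub>R g j (\<sigma> i *\<^sub>R g i x))" if "j \<in> set L" "i \<noteq> j" for j
    using i x that gen_anticommute [of i j x] by (simp add: gen_scale gen_closed)
next
  fix i assume "i \<in> set L"
  then show "linear_between U U (\<lambda>x. \<sigma> i *\<^sub>R g i x)"
    using gen_linear [of i] by (simp add: linear_between_def in_U scaleR_right_distrib)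
next
  fix X assume X: "finite X" "X \<subseteq> U" "span X \<noteq> {0}"
    "\<And>i x. i \<in> set L \<Longrightarrow> x \<in> X \<Longrightarrow> \<sigma> i *\<^sub>R g i x \<in> span X"
    "\<And>x. x \<in> span X \<Longrightarrow> (\<And>y. y \<in> X \<Longrightarrow> B x y = 0) \<Longrightarrow> x = 0"
  have "g i x \<in> span X" if "i \<in> set L" "x \<in> X" for i x
  proof -
    have "\<sigma> i *\<^sub>R (\<sigma> i *\<^sub>R g i x) \<in> span X" using X(4) [OF that] by (rule span_scale)
    then show ?thesis using \<sigma> [of i] by auto
  qed
  then show "span X = U" using minimal X by blast
qed (use subspace_U form sign sorted_L nontrivial in auto)

lemma act_sign_change:
  "set w \<subseteq> set L \<Longrightarrow> x \<in> U \<Longrightarrow>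
    word_act (\<lambda>i x. \<sigma> i *\<^sub>R g i x) w x = prod_list (map \<sigma> w) *\<^sub>R word_act g w x"
  by (induction w) (auto simp: gen_scale act_closed)

text \<open>The eigenvalues of the vector from \<open>good_vector\<close> are turned into 1 by sign
  changes of generators, found by \<open>fresh_last_signs\<close>. The zeros belonging to
  \<open>Ns\<close> are only multiplied by signs.\<close>

lemma adapted_vector_exists:
  assumes good: "good_words s L Ps Ns"
  shows "\<exists>\<sigma> v. (\<forall>i. \<sigma> i = 1 \<or> \<sigma> i = (- 1 :: real)) \<and>
    clifford_family.adapted_vector U B (\<lambda>i x. \<sigma> i *\<^sub>R g i x) Ps Ns v"
proof -
  obtain v where v: "v \<in> U" "B v v \<noteq> 0"
    "\<And>P. P \<in> set Ps \<Longrightarrow> word_act g P v = v \<or> word_act g P v = - v"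
    "\<And>N. N \<in> set Ns \<Longrightarrow> B (word_act g N v) v = 0"
    using good_vector [OF nontrivial good] by blast
  define e :: "nat list \<Rightarrow> real" where "e P = (if word_act g P v = v then 1 else - 1)" for P
  obtain \<sigma> where \<sigma>: "\<And>i. \<sigma> i = 1 \<or> \<sigma> i = (- 1 :: real)"
    "\<And>P. P \<in> set Ps \<Longrightarrow> prod_list (map \<sigma> P) = e P"
  proof -
    have "fresh_last Ps" "\<And>P. e P = 1 \<or> e P = - 1"
      using good by (auto simp: good_words_def e_def)
    then show thesis using fresh_last_signs [of Ps e] that by blast
  qed
  interpret f: minimal_clifford_family U B "\<lambda>i x. \<sigma> i *\<^sub>R g i x" s L
    using \<sigma>(1) by (rule sign_change)
  have "word_act (\<lambda>i x. \<sigma> i *\<^sub>R g i x) P v = v" if "P \<in> set Ps" for P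
  proof -
    have "set P \<subseteq> set L" using good that by (auto simp: good_words_def)
    then show ?thesis using v(3) [OF that] \<sigma>(2) [OF that] act_sign_change [of P v \<sigma>] v(1)
      by (auto simp: e_def)
  qed
  moreover have "B (word_act (\<lambda>i x. \<sigma> i *\<^sub>R g i x) N v) v = 0" if "N \<in> set Ns" for N
  proof -
    have "set N \<subseteq> set L" using good that by (auto simp: good_words_def)
    then show ?thesis using v(4) [OF that] act_sign_change [of N v \<sigma>] v(1)
      by (simp add: form_simps act_closed)
  qed
  ultimately have "f.adapted_vector Ps Ns v"
    using v by (simp add: f.adapted_vector_def)
  then show ?thesis using \<sigma>(1) by blast
qed

end

subsection \<open>Isomorphisms from equal Gram matrices\<close>

definition bilinear_on :: "'u::real_vector set \<Rightarrow> ('u \<Rightarrow> 'u \<Rightarrow> real) \<Rightarrow> bool" where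
  "bilinear_on U \<beta> \<longleftrightarrow>
    (\<forall>x\<in>U. linear_between U UNIV (\<beta> x) \<and> linear_between U UNIV (\<lambda>y. \<beta> y x))"

lemma bilinear_on_add:
  assumes "bilinear_on U \<beta>" "x \<in> U" "y \<in> U" "z \<in> U"
  shows "\<beta> x (y + z) = \<beta> x y + \<beta> x z" "\<beta> (y + z) x = \<beta> y x + \<beta> z x"
  using assms by (simp_all add: bilinear_on_def linear_between_def)

lemma bilinear_on_scale:
  assumes "bilinear_on U \<beta>" "x \<in> U" "y \<in> U"
  shows "\<beta> x (c *\<^sub>R y) = c * \<beta> x y" "\<beta> (c *\<^sub>R y) x = c * \<beta> y x"
  using assms by (simp_all add: bilinear_on_def linear_between_def)

lemma linear_between_eq_on_span:
  fixes f f' :: "'u::real_vector \<Rightarrow> real"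
  assumes "linear_between (span S) UNIV f" "linear_between (span S) UNIV f'"
    and "\<And>x. x \<in> S \<Longrightarrow> f x = f' x" and "x \<in> span S"
  shows "f x = f' x"
proof -
  have zero: "f 0 = 0" "f' 0 = 0"
    using assms(1,2) span_zero [of S] unfolding linear_between_def
    by (metis scaleR_zero_left)+
  have "subspace {x \<in> span S. f x = f' x}"
    using assms(1,2) zero
    by (auto simp: subspace_def linear_between_def span_zero span_add span_scale)
  then have "span S \<subseteq> {x \<in> span S. f x = f' x}"
    using assms(3) by (intro span_minimal) (auto simp: span_base)
  then show ?thesis using assms(4) by auto
qed

text \<open>The \<open>x\<close> that have a partner form a subspace, and \<open>b i\<close> is a
  partner of \<open>a i\<close> by equality of the Gram matrices. The families may be linearly
  dependent, so a map cannot simply be prescribed on the \<open>a i\<close>.\<close>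

lemma gram_partner:
  assumes "\<And>k. k \<in> K \<Longrightarrow> bilinear_on (span (a ` I)) (\<beta> k)"
    and "\<And>k. k \<in> K \<Longrightarrow> bilinear_on (span (b ` I)) (\<gamma> k)"
    and gram: "\<And>k i j. k \<in> K \<Longrightarrow> i \<in> I \<Longrightarrow> j \<in> I \<Longrightarrow> \<beta> k (a i) (a j) = \<gamma> k (b i) (b j)"
    and x: "x \<in> span (a ` I)"
  shows "\<exists>y\<in>span (b ` I). \<forall>k\<in>K. \<forall>i\<in>I. \<beta> k x (a i) = \<gamma> k y (b i)"
proof -
  let ?R = "\<lambda>x y. \<forall>k\<in>K. \<forall>i\<in>I. \<beta> k x (a i) = \<gamma> k y (b i)"
  let ?W = "{x \<in> span (a ` I). \<exists>y\<in>span (b ` I). ?R x y}"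
  have ab: "a i \<in> span (a ` I)" "b i \<in> span (b ` I)" if "i \<in> I" for i
    using that by (auto simp: span_base)
  have scale: "?R (c *\<^sub>R x) (c *\<^sub>R y)"
    if "x \<in> span (a ` I)" "y \<in> span (b ` I)" "?R x y" for x y and c :: real
    using that ab bilinear_on_scale(2) [OF assms(1)] bilinear_on_scale(2) [OF assms(2)] by simp
  have add: "?R (x + x') (y + y')"
    if "x \<in> span (a ` I)" "y \<in> span (b ` I)" "?R x y"
      "x' \<in> span (a ` I)" "y' \<in> span (b ` I)" "?R x' y'" for x y x' y'
    using that ab bilinear_on_add(2) [OF assms(1)] bilinear_on_add(2) [OF assms(2)] by simp
  \<comment> \<open>Zero is written as a multiple so that homogeneity shows the vanishing of the
    forms there.\<close>
  have "?R (0 *\<^sub>R 0) (0 *\<^sub>R 0)"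
  proof (intro ballI)
    fix k i assume "k \<in> K" "i \<in> I"
    then show "\<beta> k (0 *\<^sub>R 0) (a i) = \<gamma> k (0 *\<^sub>R 0) (b i)"
      using bilinear_on_scale(2) [OF assms(1) ab(1) span_zero, of k i 0]
        bilinear_on_scale(2) [OF assms(2) ab(2) span_zero, of k i 0] by simp
  qed
  then have "0 \<in> ?W" by (auto intro!: bexI [of _ 0] simp: span_zero)
  moreover have "x + x' \<in> ?W" if xx: "x \<in> ?W" "x' \<in> ?W" for x x'
  proof -
    obtain y y' where "y \<in> span (b ` I)" "y' \<in> span (b ` I)" "?R x y" "?R x' y'"
      using xx by auto
    then have "y + y' \<in> span (b ` I)" "?R (x + x') (y + y')"
      using add [of x y x' y'] xx span_add by blast+
    then show ?thesis using xx span_add by blast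
  qed
  moreover have "c *\<^sub>R x \<in> ?W" if xx: "x \<in> ?W" for c x
  proof -
    obtain y where "y \<in> span (b ` I)" "?R x y" using xx by auto
    then have "c *\<^sub>R y \<in> span (b ` I)" "?R (c *\<^sub>R x) (c *\<^sub>R y)"
      using scale [of x y c] xx span_scale by blast+
    then show ?thesis using xx span_scale by blast
  qed
  ultimately have "subspace ?W" by (simp only: subspace_def) blast
  moreover have "a ` I \<subseteq> ?W" using ab gram by blast
  ultimately have "span (a ` I) \<subseteq> ?W" by (rule span_minimal [rotated])
  then show ?thesis using x by blast
qed

lemma gram_determines:
  assumes "bilinear_on (span (a ` I)) \<beta>"
    and nondeg: "\<And>x. x \<in> span (a ` I) \<Longrightarrow> (\<And>y. y \<in> span (a ` I) \<Longrightarrow> \<beta> x y = 0) \<Longrightarrow> x = 0"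
    and x: "x \<in> span (a ` I)" "x' \<in> span (a ` I)" and eq: "\<And>i. i \<in> I \<Longrightarrow> \<beta> x (a i) = \<beta> x' (a i)"
  shows "x = x'"
proof -
  have lin: "linear_between (span (a ` I)) UNIV (\<beta> z)" if "z \<in> span (a ` I)" for z
    using assms(1) that by (simp add: bilinear_on_def)
  have "\<beta> (x + (- 1) *\<^sub>R x') y = 0" if y: "y \<in> span (a ` I)" for y
  proof -
    have "\<beta> x y = \<beta> x' y"
      using eq by (intro linear_between_eq_on_span [OF lin [OF x(1)] lin [OF x(2)] _ y]) auto
    moreover have "\<beta> (x + (- 1) *\<^sub>R x') y = \<beta> x y + (- 1) * \<beta> x' y"
      using bilinear_on_add(2) [OF assms(1) y x(1) span_scale [OF x(2), of "- 1"]]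
        bilinear_on_scale(2) [OF assms(1) y x(2), of "- 1"] by simp
    ultimately show ?thesis by simp
  qed
  then have "x + (- 1) *\<^sub>R x' = 0" using x span_add span_scale by (intro nondeg) blast+
  then show ?thesis by simp
qed

text \<open>The image of \<open>x\<close> is the vector with the same pairings against the
  \<open>b i\<close>. It exists by \<open>gram_partner\<close> and is unique because the form with
  index \<open>l\<close> is nondegenerate; uniqueness gives linearity. Exchanging the two sides
  gives surjectivity.\<close>

lemma gram_isomorphism:
  fixes a :: "'i \<Rightarrow> 'u::real_vector" and b :: "'i \<Rightarrow> 'v::real_vector"
    and \<beta> :: "'k \<Rightarrow> 'u \<Rightarrow> 'u \<Rightarrow> real" and \<gamma> :: "'k \<Rightarrow> 'v \<Rightarrow> 'v \<Rightarrow> real"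
  assumes U: "U = span (a ` I)" and V: "V = span (b ` I)"
    and bil: "\<And>k. k \<in> K \<Longrightarrow> bilinear_on U (\<beta> k)" "\<And>k. k \<in> K \<Longrightarrow> bilinear_on V (\<gamma> k)"
    and gram: "\<And>k i j. k \<in> K \<Longrightarrow> i \<in> I \<Longrightarrow> j \<in> I \<Longrightarrow> \<beta> k (a i) (a j) = \<gamma> k (b i) (b j)"
    and l: "l \<in> K"
    and nondeg: "\<And>x. x \<in> U \<Longrightarrow> (\<And>y. y \<in> U \<Longrightarrow> \<beta> l x y = 0) \<Longrightarrow> x = 0"
      "\<And>x. x \<in> V \<Longrightarrow> (\<And>y. y \<in> V \<Longrightarrow> \<gamma> l x y = 0) \<Longrightarrow> x = 0"
  shows "\<exists>A. linear_between U V A \<and> bij_betw A U V \<and>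
    (\<forall>k\<in>K. \<forall>x\<in>U. \<forall>y\<in>U. \<beta> k x y = \<gamma> k (A x) (A y))"
proof -
  let ?R = "\<lambda>x y. \<forall>k\<in>K. \<forall>i\<in>I. \<beta> k x (a i) = \<gamma> k y (b i)"
  have "\<exists>y\<in>V. ?R x y" if "x \<in> U" for x
    using that bil gram gram_partner [of K a I \<beta> b \<gamma> x] by (simp add: U V)
  then obtain A where A: "\<And>x. x \<in> U \<Longrightarrow> A x \<in> V" "\<And>x. x \<in> U \<Longrightarrow> ?R x (A x)" by metis
  have "\<exists>x\<in>U. \<forall>k\<in>K. \<forall>i\<in>I. \<gamma> k y (b i) = \<beta> k x (a i)" if "y \<in> V" for y
    using that bil gram gram_partner [of K b I \<gamma> a \<beta> y] by (simp add: U V)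
  then have B: "\<exists>x\<in>U. ?R x y" if "y \<in> V" for y
    using that by metis
  have eqU: "x = x'" if "x \<in> U" "x' \<in> U" "\<And>i. i \<in> I \<Longrightarrow> \<beta> l x (a i) = \<beta> l x' (a i)" for x x'
    using that bil(1) [OF l] nondeg(1) gram_determines [of a I "\<beta> l" x x'] by (simp add: U)
  have eqV: "y = y'" if "y \<in> V" "y' \<in> V" "\<And>i. i \<in> I \<Longrightarrow> \<gamma> l y (b i) = \<gamma> l y' (b i)" for y y'
    using that bil(2) [OF l] nondeg(2) gram_determines [of b I "\<gamma> l" y y'] by (simp add: V)
  have aU: "a i \<in> U" and bV: "b i \<in> V" if "i \<in> I" for i
    using that by (auto simp: U V span_base)
  have UV: "subspace U" "subspace V" by (simp_all add: U V)
  have unique: "A x = y" if "x \<in> U" "y \<in> V" "?R x y" for x y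
    using A [OF that(1)] that(3) l by (intro eqV that A) auto
  have Aa: "A (a i) = b i" if "i \<in> I" for i
    using aU bV gram that by (intro unique) auto
  have Aadd: "A (x + y) = A x + A y" if "x \<in> U" "y \<in> U" for x y
  proof (rule unique)
    show "?R (x + y) (A x + A y)"
      using A that aU bV bilinear_on_add(2) [OF bil(1)] bilinear_on_add(2) [OF bil(2)] by simp
  qed (use that A UV in \<open>auto simp: subspace_add\<close>)
  have Ascale: "A (c *\<^sub>R x) = c *\<^sub>R A x" if "x \<in> U" for x c
  proof (rule unique)
    show "?R (c *\<^sub>R x) (c *\<^sub>R A x)"
      using A that aU bV bilinear_on_scale(2) [OF bil(1)] bilinear_on_scale(2) [OF bil(2)] by simp
  qed (use that A UV in \<open>auto simp: subspace_scale\<close>)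
  have "linear_between U V A"
    using A(1) Aadd Ascale by (simp add: linear_between_def)
  moreover have "bij_betw A U V"
  proof (rule bij_betw_imageI)
    show "inj_on A U"
    proof (rule inj_onI)
      fix x x' assume "x \<in> U" "x' \<in> U" "A x = A x'"
      then show "x = x'" using A(2) l by (intro eqU) auto
    qed
    show "A ` U = V" using A(1) B unique by blast
  qed
  moreover have "\<beta> k x y = \<gamma> k (A x) (A y)" if k: "k \<in> K" and x: "x \<in> U" and y: "y \<in> U" for k x y
  proof (rule linear_between_eq_on_span [of "a ` I" "\<beta> k x" "\<lambda>y. \<gamma> k (A x) (A y)"])
    show "linear_between (span (a ` I)) UNIV (\<beta> k x)"
      using bil(1) [OF k] x by (simp add: bilinear_on_def U)
    show "linear_between (span (a ` I)) UNIV (\<lambda>y. \<gamma> k (A x) (A y))"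
      using A(1) x Aadd Ascale bilinear_on_add(1) [OF bil(2) [OF k]] bilinear_on_scale(1) [OF bil(2) [OF k]]
      by (simp add: linear_between_def flip: U)
    show "\<beta> k x z = \<gamma> k (A x) (A z)" if "z \<in> a ` I" for z
      using that Aa A(2) [OF x] k by auto
    show "y \<in> span (a ` I)" using y U by simp
  qed
  ultimately show ?thesis by blast
qed

subsection \<open>Matching a family with its sign reversal\<close>

text \<open>The four terms expand \<open>C (M u) u\<close> for \<open>u = v' + T v'\<close>, the
  second \<open>T\<close> being moved across by symmetry. \<open>T\<close> fixes \<open>v\<close> on
  one side and squares to -1 on the other; \<open>R\<close> fixes \<open>v'\<close> and commutes
  with \<open>T\<close>. Both have odd length, so they switch the parity of words.\<close>

definition matching_words ::
    "(nat \<Rightarrow> int) \<Rightarrow> nat list \<Rightarrow> nat list \<Rightarrow> nat list \<Rightarrow> nat list list \<Rightarrow> nat list list \<Rightarrow> bool" where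
  "matching_words s L T R Ps Qs \<longleftrightarrow>
    L \<noteq> [] \<and> T \<in> set Ps \<and> odd (length T) \<and> R \<in> set Qs \<and> odd (length R) \<and>
    clif_ratio (\<lambda>i. - s i) (T @ T) [] = - 1 \<and> sym_word (\<lambda>i. - s i) T \<and>
    comm_sign (\<lambda>i. - s i) T R = 1 \<and>
    (\<forall>M\<in>set (subseqs L). if even (length M) then True else
      2 * word_value s Ps M = (- 1) ^ (length M div 2) *
       (word_value (\<lambda>i. - s i) Qs M + word_value (\<lambda>i. - s i) Qs (M @ T) +
        word_value (\<lambda>i. - s i) Qs (T @ M) + word_value (\<lambda>i. - s i) Qs (T @ M @ T)))"

lemma (in clifford_family) form_word_value:
  assumes "adapted_vector Ps Ns v" "good_words s L Ps Ns" "complete_words s L Ps Ns" "set w \<subseteq> set L"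
  shows "B (word_act g w v) v = of_int (word_value s Ps w) * B v v"
proof -
  have "v \<in> U" using assms(1) by (simp add: adapted_vector_def)
  then show ?thesis using act_word_value [OF assms] by (auto simp: form_simps)
qed

lemma (in clifford_family) bilinear_generator:
  assumes "i \<in> set L"
  shows "bilinear_on U (\<lambda>x y. c * B (g i x) y)"
  using assms by (simp add: bilinear_on_def linear_between_def gen_add gen_scale gen_closed
      form_simps in_U algebra_simps)

lemma (in clifford_family) generator_nondegenerate:
  assumes i: "i \<in> set L" and x: "x \<in> U" and c: "c \<noteq> 0" and z: "\<And>y. y \<in> U \<Longrightarrow> c * B (g i x) y = 0"
  shows "x = 0"
proof -
  have "g i x = 0" using form_nondegenerate gen_closed [OF i x] z c by auto
  then have "of_int (s i) *\<^sub>R x = g i 0" using gen_square [OF i x] by simp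
  moreover have "g i 0 = 0" using gen_scale [OF i in_U(5), of 0] by simp
  ultimately show ?thesis using sign [of i] by auto
qed

text \<open>The orbits of \<open>v\<close> and \<open>u\<close> under even words are spanning
  families. Their Gram matrices for the skew forms of the generators consist of values of odd words,
  to which the matching condition applies.\<close>

lemma matching_isomorphism:
  fixes U :: "'u::real_vector set" and V :: "'v::real_vector set"
  assumes famU: "minimal_clifford_family U B g s L"
    and famV: "minimal_clifford_family V C h (\<lambda>i. - s i) L"
    and v: "clifford_family.adapted_vector U B g Ps Ns v"
    and v': "clifford_family.adapted_vector V C h Qs Ms v'"
    and goodU: "good_words s L Ps Ns" "complete_words s L Ps Ns"
    and goodV: "good_words (\<lambda>i. - s i) L Qs Ms" "complete_words (\<lambda>i. - s i) L Qs Ms"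
    and match: "matching_words s L T R Ps Qs"
  shows "\<exists>A \<kappa>. \<kappa> \<noteq> 0 \<and> linear_between U V A \<and> bij_betw A U V \<and>
    (\<forall>i\<in>set L. \<forall>x\<in>U. \<forall>y\<in>U. B (g i x) y = \<kappa> * C (h i (A x)) (A y))"
proof -
  interpret U: minimal_clifford_family U B g s L by (rule famU)
  interpret V: minimal_clifford_family V C h "\<lambda>i. - s i" L by (rule famV)
  have T: "T \<in> set Ps" "odd (length T)" "clif_ratio (\<lambda>i. - s i) (T @ T) [] = - 1"
      "sym_word (\<lambda>i. - s i) T" "comm_sign (\<lambda>i. - s i) T R = 1"
    and R: "R \<in> set Qs" "odd (length R)" and L: "L \<noteq> []"
    and vals: "\<And>M. M \<in> set (subseqs L) \<Longrightarrow> odd (length M) \<Longrightarrow>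
      2 * word_value s Ps M = (- 1) ^ (length M div 2) *
       (word_value (\<lambda>i. - s i) Qs M + word_value (\<lambda>i. - s i) Qs (M @ T) +
        word_value (\<lambda>i. - s i) Qs (T @ M) + word_value (\<lambda>i. - s i) Qs (T @ M @ T))"
    using match unfolding matching_words_def by (blast, blast, blast, blast, blast, blast, blast, blast, presburger)
  have TL: "set T \<subseteq> set L" and RL: "set R \<subseteq> set L"
    using T(1) R(1) goodU goodV by (auto simp: good_words_def)
  have vU: "v \<in> U" "B v v \<noteq> 0" "word_act g T v = v"
    using v T(1) by (simp_all add: U.adapted_vector_def)
  have vV: "v' \<in> V" "C v' v' \<noteq> 0" "word_act h R v' = v'"
    using v' R(1) by (simp_all add: V.adapted_vector_def)
  define u where "u = v' + word_act h T v'"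
  have TV: "word_act h T v' \<in> V" using TL vV by (simp add: V.act_closed)
  have uV: "u \<in> V" using TV vV by (simp add: u_def V.in_U)
  \<comment> \<open>Symmetry of \<open>T\<close> and its square -1 on \<open>V\<close> give
    \<open>C (T u) u = - 2 * C v' v'\<close>, whereas \<open>B (T v) v = B v v\<close>; this
    explains the 2 in the denominator.\<close>
  define \<kappa> where "\<kappa> = B v v / (2 * C v' v')"
  have \<kappa>: "\<kappa> \<noteq> 0" using vU vV by (simp add: \<kappa>_def)
  have Cu: "C (word_act h M u) u = of_int (word_value (\<lambda>i. - s i) Qs M + word_value (\<lambda>i. - s i) Qs (M @ T) +
        word_value (\<lambda>i. - s i) Qs (T @ M) + word_value (\<lambda>i. - s i) Qs (T @ M @ T)) * C v' v'"
    if M: "set M \<subseteq> set L" for M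
  proof -
    have cl: "word_act h M v' \<in> V" "word_act h (M @ T) v' \<in> V"
      using M TL vV TV by (simp_all add: V.act_closed)
    have "word_act h M u = word_act h M v' + word_act h (M @ T) v'"
      using M TV vV by (simp add: u_def V.act_add)
    then have "C (word_act h M u) u = C (word_act h M v') v' + C (word_act h M v') (word_act h T v')
        + (C (word_act h (M @ T) v') v' + C (word_act h (M @ T) v') (word_act h T v'))"
      using cl TV vV by (simp add: u_def V.form_simps V.in_U del: foldr_append)
    moreover have "C x (word_act h T v') = C (word_act h T x) v'" if "x \<in> V" for x
      using V.sym_word [OF T(4) TL that vV(1)] by simp
    ultimately have "C (word_act h M u) u = C (word_act h M v') v' + C (word_act h (T @ M) v') v'
        + (C (word_act h (M @ T) v') v' + C (word_act h (T @ M @ T) v') v')"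
      using cl by simp
    also have "\<dots> = of_int (word_value (\<lambda>i. - s i) Qs M + word_value (\<lambda>i. - s i) Qs (M @ T) +
        word_value (\<lambda>i. - s i) Qs (T @ M) + word_value (\<lambda>i. - s i) Qs (T @ M @ T)) * C v' v'"
      using V.form_word_value [OF v' goodV] M TL by (simp del: foldr_append add: algebra_simps)
    finally show ?thesis .
  qed
  \<comment> \<open>The identity is certified for normal forms only. Passing from \<open>w\<close>
    to \<open>M\<close> with \<open>t\<close> cancellations lowers \<open>length w div 2\<close> by
    \<open>t\<close>, and this sign cancels the \<open>(- 1) ^ t\<close> from reversing the
    squares.\<close>
  have odd: "B (word_act g w v) v = \<kappa> * ((- 1) ^ (length w div 2) * C (word_act h w u) u)"
    if w: "set w \<subseteq> set L" "odd (length w)" for w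
  proof -
    obtain c M where M: "clif_norm s w = (c, M)" by fastforce
    obtain t where t: "length w = length M + 2 * t" "clif_norm (\<lambda>i. - s i) w = ((- 1) ^ t * c, M)"
      using clif_norm_minus [OF M] by blast
    have sub_M: "M \<in> set (subseqs L)" "set M \<subseteq> set L"
      using U.norm_in_subseqs [OF M w(1)] U.subseqs_subset by auto
    have odd: "odd (length M)" using w t by simp
    have "B (word_act g M v) v = of_int (word_value s Ps M) * B v v"
      using U.form_word_value [OF v goodU sub_M(2)] .
    also have "of_int (word_value s Ps M) = of_int (2 * word_value s Ps M) / (2 :: real)" by simp
    also have "\<dots> * B v v = \<kappa> * ((- 1) ^ (length M div 2) * C (word_act h M u) u)"
      unfolding vals [OF sub_M(1) odd] Cu [OF sub_M(2)] \<kappa>_def using vV(2) by (simp add: field_simps)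
    finally have main: "B (word_act g M v) v = \<kappa> * ((- 1) ^ (length M div 2) * C (word_act h M u) u)" .
    have "word_act g w v = of_int c *\<^sub>R word_act g M v" using U.act_norm [OF vU(1) M w(1)] by simp
    then have 1: "B (word_act g w v) v = of_int c * B (word_act g M v) v"
      using sub_M vU by (simp add: U.form_simps U.act_closed)
    have "word_act h w u = of_int ((- 1) ^ t * c) *\<^sub>R word_act h M u"
      using V.act_norm [OF uV t(2) w(1)] by simp
    then have "C (word_act h w u) u = of_int ((- 1) ^ t * c) * C (word_act h M u) u"
      using V.form_left(2) [OF uV V.act_closed [OF sub_M(2) uV]] by simp
    moreover have "length w div 2 = length M div 2 + t" using t(1) by simp
    ultimately have "(- 1) ^ (length w div 2) * C (word_act h w u) u
        = of_int c * ((- 1) ^ (length M div 2) * C (word_act h M u) u)"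
      by (simp add: power_add flip: power_mult_distrib)
    then show ?thesis using 1 main by simp
  qed
  define I where "I = {w. set w \<subseteq> set L \<and> even (length w)}"
  define a where "a w = word_act g w v" for w
  define b where "b w = (- 1 :: real) ^ (length w div 2) *\<^sub>R word_act h w u" for w
  have spanU: "U = span (a ` I)"
  proof -
    \<comment> \<open>An odd word becomes even when \<open>T\<close>, which is odd and fixes
      \<open>v\<close>, is appended.\<close>
    have "word_act g w v \<in> a ` I" if "set w \<subseteq> set L" for w
    proof (cases "even (length w)")
      case True
      then show ?thesis using that by (auto simp: a_def I_def)
    next
      case False
      then have "w @ T \<in> I" "a (w @ T) = word_act g w v" using that TL T(2) vU(3) by (auto simp: I_def a_def)
      then show ?thesis by (metis imageI)
    qed
    moreover have "a ` I \<subseteq> (\<lambda>w. word_act g w v) ` {w. set w \<subseteq> set L}" by (auto simp: a_def I_def)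
    ultimately have "a ` I = (\<lambda>w. word_act g w v) ` {w. set w \<subseteq> set L}" by auto
    then show ?thesis using U.adapted_vector_cyclic [OF v goodU] by simp
  qed
  have spanV: "V = span (b ` I)"
  proof
    have "b ` I \<subseteq> V" using uV by (auto simp: b_def I_def V.in_U V.act_closed)
    then show "span (b ` I) \<subseteq> V" using V.subspace_U by (rule span_minimal)
    have act_u: "word_act h w u \<in> span (b ` I)" if "w \<in> I" for w
    proof -
      have "(- 1) ^ (length w div 2) *\<^sub>R b w \<in> span (b ` I)"
        using that by (simp add: span_base span_scale)
      then show ?thesis by (simp add: b_def flip: power_mult_distrib)
    qed
    have even: "word_act h w v' \<in> span (b ` I)" if "w \<in> I" for w
    proof -
      have wL: "set w \<subseteq> set L" using that by (simp add: I_def)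
      have TRv: "word_act h (T @ R) v' = word_act h T v'" using vV by simp
      have RTv: "word_act h R (word_act h T v') = word_act h T v'"
        using V.comm_word [OF T(5) _ TL RL vV(1)] vV by simp
      have TTv: "word_act h T (word_act h T v') = - v'"
        using V.act_ratio(1) [OF T(3) _ _ _ vV(1)] TL by simp
      \<comment> \<open>The even word \<open>T @ R\<close> sends \<open>u\<close> to
        \<open>T v' - v'\<close>, so \<open>v'\<close> is half of \<open>u - T R u\<close> and can
        be reached from \<open>u\<close> by even words. The odd word \<open>R\<close>, which fixes
        \<open>v'\<close>, then supplies the odd words.\<close>
      have "word_act h (T @ R) u = word_act h T v' - v'"
        using RTv TTv vV TV TL RL
        by (simp add: u_def V.act_add [OF RL vV(1) TV] V.act_add [OF TL vV(1) TV])
      then have "word_act h (w @ T @ R) u = word_act h w (word_act h T v' + (- 1) *\<^sub>R v')" by simp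
      also have "\<dots> = word_act h w (word_act h T v') + (- 1) *\<^sub>R word_act h w v'"
        using wL vV TV by (simp only: V.act_add V.act_scale V.in_U)
      finally have "word_act h w u - word_act h (w @ T @ R) u = 2 *\<^sub>R word_act h w v'"
        using wL vV TV by (simp add: u_def V.act_add scaleR_2)
      moreover have "w @ T @ R \<in> I" using that TL RL T(2) R(2) by (simp add: I_def)
      ultimately have "2 *\<^sub>R word_act h w v' \<in> span (b ` I)"
        using act_u [OF that] act_u [of "w @ T @ R"] by (metis span_diff)
      then have "(1 / 2) *\<^sub>R (2 *\<^sub>R word_act h w v') \<in> span (b ` I)" by (rule span_scale)
      then show ?thesis by simp
    qed
    have "word_act h w v' \<in> span (b ` I)" if "set w \<subseteq> set L" for w
    proof (cases "even (length w)")
      case True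
      then show ?thesis using even that by (simp add: I_def)
    next
      case False
      then have "w @ R \<in> I" using that RL R(2) by (simp add: I_def)
      then show ?thesis using even [of "w @ R"] vV by simp
    qed
    then show "V \<subseteq> span (b ` I)"
      unfolding V.adapted_vector_cyclic [OF v' goodV]
      by (intro span_minimal) auto
  qed
  \<comment> \<open>Each entry is the value of the odd word \<open>rev w' @ i # w\<close>. Half its
    length, rounded down, is the sum of the half lengths of \<open>w\<close> and \<open>w'\<close>,
    so its sign splits into those in \<open>b w\<close> and \<open>b w'\<close>. The factor 1 gives
    both sides the shape of \<open>bilinear_generator\<close>.\<close>
  have gram: "1 * B (g i (a w)) (a w') = \<kappa> * C (h i (b w)) (b w')"
    if i: "i \<in> set L" and w: "w \<in> I" "w' \<in> I" for i w w'
  proof -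
    have wL: "set w \<subseteq> set L" "set w' \<subseteq> set L" and ev: "even (length w)" "even (length w')"
      using w by (auto simp: I_def)
    have U: "word_act g (i # w) v \<in> U" and V: "word_act h (i # w) u \<in> V"
      using i wL vU uV by (auto intro!: U.act_closed V.act_closed simp del: foldr.simps)
    let ?x = "rev w' @ i # w"
    have x: "set ?x \<subseteq> set L" "odd (length ?x)" "length ?x div 2 = length w div 2 + length w' div 2"
      using i wL ev by auto
    have "B (g i (a w)) (a w') = B (word_act g w' v) (word_act g (i # w) v)"
      using U.form_sym [OF U, of "word_act g w' v"] vU wL by (simp add: a_def U.act_closed)
    also have "\<dots> = B v (word_act g ?x v)"
      using U.act_adjoint [OF wL(2) vU(1) U] ev by simp
    also have "\<dots> = B (word_act g ?x v) v"
      using vU(1) U.act_closed [OF x(1) vU(1)] by (rule U.form_sym)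
    also have "\<dots> = \<kappa> * ((- 1) ^ (length ?x div 2) * C (word_act h ?x u) u)"
      using odd x(1,2) by blast
    also have "C (word_act h ?x u) u = C u (word_act h ?x u)"
      using V.act_closed [OF x(1) uV] uV by (rule V.form_sym)
    also have "\<dots> = C (word_act h w' u) (word_act h (i # w) u)"
      using V.act_adjoint [OF wL(2) uV V] ev by simp
    also have "\<dots> = C (h i (word_act h w u)) (word_act h w' u)"
      using V.form_sym [OF V, of "word_act h w' u"] uV wL by (simp add: V.act_closed)
    also have "(- 1) ^ (length ?x div 2) * C (h i (word_act h w u)) (word_act h w' u) = C (h i (b w)) (b w')"
      unfolding b_def x(3) using i wL uV
      by (simp add: V.gen_scale V.act_closed V.form_simps V.gen_closed V.in_U power_add)
    finally show ?thesis by simp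
  qed
  have l: "hd L \<in> set L" using L by simp
  have "\<exists>A. linear_between U V A \<and> bij_betw A U V \<and>
      (\<forall>i\<in>set L. \<forall>x\<in>U. \<forall>y\<in>U. 1 * B (g i x) y = \<kappa> * C (h i (A x)) (A y))"
  proof (rule gram_isomorphism [OF spanU spanV _ _ _ l])
    show "x = 0" if "x \<in> U" "\<And>y. y \<in> U \<Longrightarrow> 1 * B (g (hd L) x) y = 0" for x
      using U.generator_nondegenerate [OF l that(1), of 1] that(2) by simp
    show "x = 0" if "x \<in> V" "\<And>y. y \<in> V \<Longrightarrow> \<kappa> * C (h (hd L) x) y = 0" for x
      using V.generator_nondegenerate [OF l that(1) \<kappa>] that(2) by simp
    show "bilinear_on U (\<lambda>x y. 1 * B (g i x) y)" if "i \<in> set L" for i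
      using that by (rule U.bilinear_generator)
    show "bilinear_on V (\<lambda>x y. \<kappa> * C (h i x) y)" if "i \<in> set L" for i
      using that by (rule V.bilinear_generator)
    show "1 * B (g i (a w)) (a w') = \<kappa> * C (h i (b w)) (b w')"
      if "i \<in> set L" "w \<in> I" "w' \<in> I" for i w w'
      using that by (rule gram)
  qed
  then show ?thesis using \<kappa> by auto
qed

subsection \<open>Minimal admissible modules\<close>

lemma independent_card_le_dim:
  assumes "finite S" "U \<subseteq> span S" "A \<subseteq> U" "independent A"
  shows "finite A \<and> card A \<le> dim U"
proof -
  obtain D where D: "D \<subseteq> U" "independent D" "U \<subseteq> span D" "card D = dim U"
    using basis_exists by blast
  have "finite D" using independent_span_bound [OF assms(1) D(2)] D(1) assms(2) by auto
  then show ?thesis using independent_span_bound [OF _ assms(4), of D] assms(3) D by auto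
qed

text \<open>A vector of \<open>U\<close> outside \<open>W\<close> would extend a basis of
  \<open>W\<close> to an independent set larger than \<open>dim U\<close>. The ambient space may be
  infinite-dimensional; \<open>S\<close> provides the finiteness.\<close>

lemma subspace_eq_if_dim_le:
  assumes U: "finite S" "U \<subseteq> span S" and W: "subspace W" "W \<subseteq> U" and dim: "dim U \<le> dim W"
  shows "W = U"
proof (rule ccontr)
  assume "W \<noteq> U"
  then obtain u where u: "u \<in> U" "u \<notin> W" using W by blast
  obtain A where A: "A \<subseteq> W" "independent A" "W \<subseteq> span A" "card A = dim W"
    using basis_exists by blast
  have "span A = W" using A W(1) span_minimal by blast
  then have "independent (insert u A)" using A(2) u by (simp add: independent_insert)
  then have "finite (insert u A)" "card (insert u A) \<le> dim U"
    using independent_card_le_dim [OF U, of "insert u A"] A(1) W(2) u by auto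
  moreover have "u \<notin> A" using A(1) u by blast
  ultimately show False using A(4) dim by auto
qed

lemma axis_component: "axis k x $ l = (if l = k then x else 0)"
  by (simp add: axis_def)

lemma axis_expansion:
  fixes J :: "real ^ 'n::finite \<Rightarrow> 'u::real_vector \<Rightarrow> 'u"
  assumes "linear (\<lambda>z. J z x)"
  shows "J z x = (\<Sum>k\<in>UNIV. z $ k *\<^sub>R J (axis k 1) x)"
proof -
  have "J z x = J (\<Sum>k\<in>UNIV. z $ k *\<^sub>R axis k 1) x"
    by (metis basis_expansion scalar_mult_eq_scaleR)
  then show ?thesis
    using linear_sum [OF assms, of "\<lambda>k. z $ k *\<^sub>R axis k 1" UNIV] linear_scale [OF assms] by simp
qed

text \<open>Polarisation of the equation for the squares, applied to \<open>z + w\<close>.\<close>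

lemma clifford_module_anticommute:
  assumes J: "clifford_module U J" and x: "x \<in> U"
  shows "J z (J w x) + J w (J z x) =
    - (pseudo_inner (z + w) (z + w) - pseudo_inner z z - pseudo_inner w w) *\<^sub>R x"
proof -
  have lin: "linear (\<lambda>z. J z y)" "J z y \<in> U" if "y \<in> U" for y z
    using J that by (auto simp: clifford_module_def linear_between_def)
  have sq: "J z (J z x) = - pseudo_inner z z *\<^sub>R x" for z
    using J x by (simp add: clifford_module_def)
  have add: "J y (J z x + J w x) = J y (J z x) + J y (J w x)" for y
    using J lin(2) [OF x] by (auto simp: clifford_module_def linear_between_def)
  have "J (z + w) (J (z + w) x) = J z (J z x) + J w (J w x) + (J z (J w x) + J w (J z x))"
    using linear_add [OF lin(1)] lin(2) x subspace_add
    by (simp add: linear_add [OF lin(1) [OF x]] linear_add [OF lin(1) [OF lin(2) [OF x]]] add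
        linear_add [OF lin(1)])
  then have "- pseudo_inner (z + w) (z + w) *\<^sub>R x =
      - pseudo_inner z z *\<^sub>R x + - pseudo_inner w w *\<^sub>R x + (J z (J w x) + J w (J z x))"
    by (simp only: sq)
  then show ?thesis by (simp add: algebra_simps)
qed

lemma axis_anticommute:
  fixes J :: "real ^ ('r::finite + 's::finite) \<Rightarrow> 'u::real_vector \<Rightarrow> 'u"
  assumes J: "clifford_module U J" and x: "x \<in> U" and "k \<noteq> l"
  shows "J (axis k 1) (J (axis l 1) x) = - J (axis l 1) (J (axis k 1) x)"
proof -
  let ?z = "axis k 1 :: real ^ ('r + 's)" and ?w = "axis l 1 :: real ^ ('r + 's)"
  have add: "pseudo_inner (a + b) c = pseudo_inner a c + pseudo_inner b c" for a b c :: "real ^ ('r + 's)"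
    by (simp add: pseudo_inner_def algebra_simps sum.distrib)
  have "pseudo_inner (?z + ?w) (?z + ?w) = pseudo_inner ?z ?z + pseudo_inner ?w ?w"
    using \<open>k \<noteq> l\<close> by (cases k; cases l) (auto simp: add pseudo_inner_axis axis_component)
  then show ?thesis
    using clifford_module_anticommute [OF J x, of ?z ?w] by (simp add: add_eq_0_iff2)
qed

text \<open>A span stable under the axis generators is stable under all \<open>J z\<close> by
  linearity in \<open>z\<close>. If \<open>B\<close> is nondegenerate on it, it is itself an
  admissible module, and comparison of dimensions forces it to be \<open>U\<close>.\<close>

lemma minimal_admissible_clifford_family:
  fixes J :: "real ^ ('r::finite + 's::finite) \<Rightarrow> 'u::real_vector \<Rightarrow> 'u"
  assumes min: "minimal_admissible_module U J B"
    and e: "bij_betw e (set L) UNIV" and L: "sorted_wrt (<) L"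
    and sgn: "\<And>i. s i = 1 \<or> s i = - 1"
    and sq: "\<And>i. i \<in> set L \<Longrightarrow>
      pseudo_inner (axis (e i) 1) (axis (e i) 1 :: real ^ ('r + 's)) = - of_int (s i)"
  shows "minimal_clifford_family U B (\<lambda>i. J (axis (e i) 1)) s L"
proof -
  have adm: "admissible_module U J B" and nz: "U \<noteq> {0}"
    using min by (auto simp: minimal_admissible_module_def)
  have J: "clifford_module U J" and B: "nondegenerate_symmetric_form U B"
    and skew: "\<And>z x y. x \<in> U \<Longrightarrow> y \<in> U \<Longrightarrow> B (J z x) y + B x (J z y) = 0"
    using adm by (auto simp: admissible_module_def)
  have sub: "subspace U" and lin: "\<And>z. linear_between U U (J z)"
    and linz: "\<And>x. x \<in> U \<Longrightarrow> linear (\<lambda>z. J z x)"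
    and square: "\<And>z x. x \<in> U \<Longrightarrow> J z (J z x) = - pseudo_inner z z *\<^sub>R x"
    using J by (auto simp: clifford_module_def fin_dim_subspace_def)
  obtain S where S: "finite S" "U = span S"
    using J by (auto simp: clifford_module_def fin_dim_subspace_def)
  show ?thesis
  proof
    fix i x assume "i \<in> set L" "x \<in> U"
    then show "J (axis (e i) 1) (J (axis (e i) 1) x) = of_int (s i) *\<^sub>R x"
      using square sq by simp
  next
    fix i j x assume "i \<in> set L" "j \<in> set L" "i \<noteq> j" "x \<in> U"
    moreover from this have "e i \<noteq> e j" using e by (auto simp: bij_betw_def inj_on_def)
    ultimately show "J (axis (e i) 1) (J (axis (e j) 1) x) = - J (axis (e j) 1) (J (axis (e i) 1) x)"
      using axis_anticommute [OF J] by blast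
  next
    fix i x y assume "x \<in> U" "y \<in> U"
    then show "B (J (axis (e i) 1) x) y = - B x (J (axis (e i) 1) y)"
      using skew [of x y] by (simp add: add_eq_0_iff2)
  next
    fix X assume X: "finite X" "X \<subseteq> U" "span X \<noteq> {0}"
      "\<And>i x. i \<in> set L \<Longrightarrow> x \<in> X \<Longrightarrow> J (axis (e i) 1) x \<in> span X"
      "\<And>x. x \<in> span X \<Longrightarrow> (\<And>y. y \<in> X \<Longrightarrow> B x y = 0) \<Longrightarrow> x = 0"
    have W: "span X \<subseteq> U" using X(2) sub by (rule span_minimal)
    then have inU: "x \<in> U" if "x \<in> span X" for x using that by blast
    have "J (axis k 1) x \<in> span X" if x: "x \<in> span X" for k x
    proof -
      obtain i where i: "i \<in> set L" "e i = k"
        using e unfolding bij_betw_def by (metis UNIV_I imageE)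
      have lin': "J (axis k 1) (x + y) = J (axis k 1) x + J (axis k 1) y"
          "J (axis k 1) (c *\<^sub>R x) = c *\<^sub>R J (axis k 1) x" if "x \<in> U" "y \<in> U" for x y c
        using lin [of "axis k 1"] that by (simp_all add: linear_between_def)
      have zero: "J (axis k 1) 0 = 0"
        using lin'(2) [of 0 0 0] sub by (simp add: subspace_0)
      have "subspace {x \<in> U. J (axis k 1) x \<in> span X}"
        using sub lin' zero by (auto simp: subspace_def span_zero span_add span_scale)
      moreover have "X \<subseteq> {x \<in> U. J (axis k 1) x \<in> span X}" using X(2,4) i by auto
      ultimately have "span X \<subseteq> {x \<in> U. J (axis k 1) x \<in> span X}" by (rule span_minimal [rotated])
      then show ?thesis using x by blast
    qed
    then have JW: "J z x \<in> span X" if "x \<in> span X" for z x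
      using that axis_expansion [of J x z, OF linz [OF inU [OF that]]]
      by (simp add: span_sum span_scale)
    have "linear_between (span X) (span X) (J z)" for z
      using lin [of z] JW inU by (simp add: linear_between_def)
    then have "clifford_module (span X) J"
      using X(1) linz square inU by (auto simp: clifford_module_def fin_dim_subspace_def)
    moreover have "nondegenerate_symmetric_form (span X) B"
      using B inU X(5) span_base [of _ X] unfolding nondegenerate_symmetric_form_def linear_between_def
      by auto
    ultimately have "admissible_module (span X) J B"
      using skew inU by (simp add: admissible_module_def)
    then have "dim U \<le> dim (span X)"
      using minimal_admissible_module_le [OF min] X(3) by blast
    then show "span X = U"
      using subspace_eq_if_dim_le [OF S(1) _ subspace_span W] S(2) by blast
  qed (use sub B lin sgn L nz in auto)
qed

subsection \<open>The isomorphism of Lie algebras\<close>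

definition swap_sum :: "'s + 'r \<Rightarrow> 'r + 's" where
  "swap_sum = case_sum Inr Inl"

lemma swap_sum_simps [simp]: "swap_sum (Inl a) = Inr a" "swap_sum (Inr b) = Inl b"
  "swap_sum (swap_sum k) = k"
  by (auto simp: swap_sum_def split: sum.split)

text \<open>Rescaling the skew form of each central direction is undone by rescaling the
  corresponding coordinate of the bracket, so \<open>A\<close> extends by a diagonal map of the
  centres.\<close>

lemma lie_isomorphicI:
  fixes J :: "real ^ ('r::finite + 's::finite) \<Rightarrow> 'u::real_vector \<Rightarrow> 'u"
    and K :: "real ^ ('s + 'r) \<Rightarrow> 'v::real_vector \<Rightarrow> 'v"
    and c :: "'r + 's \<Rightarrow> real"
  assumes J: "admissible_module U J B" and K: "admissible_module V K C"
    and A: "linear_between U V A" "bij_betw A U V" and c: "\<And>k. c k \<noteq> 0"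
    and eq: "\<And>k x y. x \<in> U \<Longrightarrow> y \<in> U \<Longrightarrow>
      B (J (axis k 1) x) y = c k * C (K (axis (swap_sum k) 1) (A x)) (A y)"
  shows "lie_isomorphic
    (pseudo_H_carrier U :: ('u \<times> (real ^ ('r + 's))) set) (pseudo_H_bracket J B)
    (pseudo_H_carrier V :: ('v \<times> (real ^ ('s + 'r))) set) (pseudo_H_bracket K C)"
proof -
  \<comment> \<open>The minus sign arises because \<open>swap_sum\<close> exchanges positive and
    negative axes, so exactly one of the two coordinates is read off with a sign.\<close>
  define T :: "real ^ ('r + 's) \<Rightarrow> real ^ ('s + 'r)"
    where "T w = (\<chi> l. - w $ swap_sum l / c (swap_sum l))" for w
  define T' :: "real ^ ('s + 'r) \<Rightarrow> real ^ ('r + 's)"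
    where "T' w = (\<chi> k. - c k * w $ swap_sum k)" for w
  have TT': "T (T' w) = w" "T' (T w') = w'" for w w'
    using c by (simp_all add: T_def T'_def vec_eq_iff)
  have AV: "A x \<in> V" if "x \<in> U" for x using A(1) that by (simp add: linear_between_def)
  have bracket: "T (center_bracket J B x y) = center_bracket K C (A x) (A y)"
    if x: "x \<in> U" and y: "y \<in> U" for x y
  proof -
    have "T (center_bracket J B x y) $ l = center_bracket K C (A x) (A y) $ l" for l
    proof -
      have "pseudo_inner (axis (swap_sum l) 1) (center_bracket J B x y) =
          c (swap_sum l) * pseudo_inner (axis l 1) (center_bracket K C (A x) (A y))"
        using eq [OF x y, of "swap_sum l"] center_bracket [OF J x y, of "axis (swap_sum l) 1"]
          center_bracket [OF K AV [OF x] AV [OF y], of "axis l 1"] by simp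
      then show ?thesis
        using c [of "swap_sum l"] by (cases l) (auto simp: pseudo_inner_axis T_def field_simps)
    qed
    then show ?thesis by (simp add: vec_eq_iff)
  qed
  have U0: "0 \<in> U"
    using J subspace_0 by (auto simp: admissible_module_def clifford_module_def fin_dim_subspace_def)
  then have A0: "A 0 = 0" using A(1) unfolding linear_between_def by (metis scaleR_zero_left)
  have "linear_between (pseudo_H_carrier U) (pseudo_H_carrier V) (map_prod A T)"
    using A(1) by (auto simp: linear_between_def pseudo_H_carrier_def T_def vec_eq_iff add_divide_distrib diff_divide_distrib)
  moreover have "bij_betw (map_prod A T) (pseudo_H_carrier U) (pseudo_H_carrier V)"
    unfolding pseudo_H_carrier_def
    using bij_betw_map_prod [OF A(2), of T UNIV UNIV] TT' by (metis bij_betw_byWitness subset_UNIV)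
  moreover have "map_prod A T (pseudo_H_bracket J B p q) =
      pseudo_H_bracket K C (map_prod A T p) (map_prod A T q)"
    if "p \<in> pseudo_H_carrier U" "q \<in> pseudo_H_carrier U" for p q
    using that A0 bracket by (auto simp: pseudo_H_bracket_def pseudo_H_carrier_def)
  ultimately show ?thesis unfolding lie_isomorphic_def by blast
qed

text \<open>
  The labels up to \<open>6\<close> are the positive directions on one side and the negative ones on the other.
\<close>

definition label_sign :: "nat \<Rightarrow> int" where
  "label_sign i = (if i \<le> 6 then - 1 else 1)"

lemma labelling_exists:
  assumes "card {i \<in> set L. i \<le> 6} = CARD('r::finite)" "card {i \<in> set L. \<not> i \<le> 6} = CARD('s::finite)"
  shows "\<exists>e :: nat \<Rightarrow> 'r + 's. bij_betw e (set L) UNIV \<and> (\<forall>i\<in>set L. isl (e i) \<longleftrightarrow> i \<le> 6)"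
proof -
  obtain f :: "nat \<Rightarrow> 'r" where f: "bij_betw f {i \<in> set L. i \<le> 6} UNIV"
    using finite_same_card_bij [of "{i \<in> set L. i \<le> 6}" "UNIV :: 'r set"] assms(1) by auto
  obtain f' :: "nat \<Rightarrow> 's" where f': "bij_betw f' {i \<in> set L. \<not> i \<le> 6} UNIV"
    using finite_same_card_bij [of "{i \<in> set L. \<not> i \<le> 6}" "UNIV :: 's set"] assms(2) by auto
  define e where "e i = (if i \<le> 6 then Inl (f i) else Inr (f' i))" for i
  have "bij_betw e (set L) UNIV"
  proof (rule bij_betw_imageI)
    show "inj_on e (set L)"
      using f f' by (auto simp: e_def bij_betw_def inj_on_def)
    have "k \<in> e ` set L" for k
    proof (cases k)
      case (Inl a)
      then obtain i where "i \<in> set L" "i \<le> 6" "a = f i" using f by (force simp: bij_betw_def)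
      then show ?thesis using Inl by (auto simp: e_def intro!: image_eqI [of _ _ i])
    next
      case (Inr a)
      then obtain i where "i \<in> set L" "\<not> i \<le> 6" "a = f' i" using f' by (force simp: bij_betw_def)
      then show ?thesis using Inr by (auto simp: e_def intro!: image_eqI [of _ _ i])
    qed
    then show "e ` set L = UNIV" by auto
  qed
  then show ?thesis by (intro exI [of _ e]) (auto simp: e_def)
qed

section \<open>Finite certificates and the resulting isomorphisms\<close>

definition matching_data :: "nat list \<Rightarrow> nat list \<Rightarrow> nat list \<Rightarrow>
    nat list list \<Rightarrow> nat list list \<Rightarrow> nat list list \<Rightarrow> nat list list \<Rightarrow> bool" where
  "matching_data L T R Ps Ns Qs Ms \<longleftrightarrow> sorted_wrt (<) L \<and>
    good_words label_sign L Ps Ns \<and> complete_words label_sign L Ps Ns \<and>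
    good_words (\<lambda>i. - label_sign i) L Qs Ms \<and> complete_words (\<lambda>i. - label_sign i) L Qs Ms \<and>
    matching_words label_sign L T R Ps Qs"

text \<open>One labelling serves both modules, through \<open>swap_sum\<close> on the second. The
  sign changes that make the vectors adapted are absorbed, together with \<kappa>, into the scaling
  factors of the central directions.\<close>

lemma lie_isomorphic_if_matching:
  fixes U :: "'u::real_vector set"
    and J :: "real ^ ('r::finite + 's::finite) \<Rightarrow> 'u \<Rightarrow> 'u"
    and V :: "'v::real_vector set"
    and K :: "real ^ ('s + 'r) \<Rightarrow> 'v \<Rightarrow> 'v"
  assumes minU: "minimal_admissible_module U J B" and minV: "minimal_admissible_module V K C"
    and card: "length (filter (\<lambda>i. i \<le> 6) L) = CARD('r)" "length (filter (\<lambda>i. \<not> i \<le> 6) L) = CARD('s)"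
    and data: "matching_data L T R Ps Ns Qs Ms"
  shows "lie_isomorphic
    (pseudo_H_carrier U :: ('u \<times> (real ^ ('r + 's))) set) (pseudo_H_bracket J B)
    (pseudo_H_carrier V :: ('v \<times> (real ^ ('s + 'r))) set) (pseudo_H_bracket K C)"
proof -
  have L: "sorted_wrt (<) L"
    and goodU: "good_words label_sign L Ps Ns" "complete_words label_sign L Ps Ns"
    and goodV: "good_words (\<lambda>i. - label_sign i) L Qs Ms" "complete_words (\<lambda>i. - label_sign i) L Qs Ms"
    and match: "matching_words label_sign L T R Ps Qs"
    using data by (simp_all add: matching_data_def)
  have "distinct L" using L by (simp add: strict_sorted_iff)
  then have count: "card {i \<in> set L. p i} = length (filter p L)" for p
    by (metis distinct_card distinct_filter set_filter)
  obtain e :: "nat \<Rightarrow> 'r + 's" where e: "bij_betw e (set L) UNIV" "\<And>i. i \<in> set L \<Longrightarrow> isl (e i) \<longleftrightarrow> i \<le> 6"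
    using labelling_exists [where 'r = 'r and 's = 's, of L] card unfolding count by blast
  have "bij_betw swap_sum (UNIV :: ('r + 's) set) (UNIV :: ('s + 'r) set)"
    by (rule bij_betw_byWitness [where f' = swap_sum]) auto
  from bij_betw_trans [OF e(1) this]
  have e': "bij_betw (\<lambda>i. swap_sum (e i)) (set L) (UNIV :: ('s + 'r) set)" by (simp add: o_def)
  have famU: "minimal_clifford_family U B (\<lambda>i. J (axis (e i) 1)) label_sign L"
  proof (rule minimal_admissible_clifford_family [OF minU e(1) L])
    show "pseudo_inner (axis (e i) 1) (axis (e i) 1 :: real ^ ('r + 's)) = - of_int (label_sign i)"
      if "i \<in> set L" for i
      using e(2) [OF that] by (cases "e i") (auto simp: pseudo_inner_axis label_sign_def axis_component)
  qed (simp add: label_sign_def)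
  have famV: "minimal_clifford_family V C (\<lambda>i. K (axis (swap_sum (e i)) 1)) (\<lambda>i. - label_sign i) L"
  proof (rule minimal_admissible_clifford_family [OF minV e' L])
    show "pseudo_inner (axis (swap_sum (e i)) 1) (axis (swap_sum (e i)) 1 :: real ^ ('s + 'r)) =
        - of_int (- label_sign i)"
      if "i \<in> set L" for i
      using e(2) [OF that] by (cases "e i") (auto simp: pseudo_inner_axis label_sign_def axis_component)
  qed (simp add: label_sign_def)
  obtain \<sigma> v where \<sigma>: "\<And>i. \<sigma> i = 1 \<or> \<sigma> i = (- 1 :: real)"
    and v: "clifford_family.adapted_vector U B (\<lambda>i x. \<sigma> i *\<^sub>R J (axis (e i) 1) x) Ps Ns v"
    using minimal_clifford_family.adapted_vector_exists [OF famU goodU(1)] by blast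
  obtain \<tau> v' where \<tau>: "\<And>i. \<tau> i = 1 \<or> \<tau> i = (- 1 :: real)"
    and v': "clifford_family.adapted_vector V C (\<lambda>i x. \<tau> i *\<^sub>R K (axis (swap_sum (e i)) 1) x) Qs Ms v'"
    using minimal_clifford_family.adapted_vector_exists [OF famV goodV(1)] by blast
  obtain A \<kappa> where \<kappa>: "\<kappa> \<noteq> 0" and A: "linear_between U V A" "bij_betw A U V"
    and eq: "\<And>i x y. i \<in> set L \<Longrightarrow> x \<in> U \<Longrightarrow> y \<in> U \<Longrightarrow>
      B (\<sigma> i *\<^sub>R J (axis (e i) 1) x) y = \<kappa> * C (\<tau> i *\<^sub>R K (axis (swap_sum (e i)) 1) (A x)) (A y)"
    using matching_isomorphism [OF minimal_clifford_family.sign_change [OF famU \<sigma>]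
        minimal_clifford_family.sign_change [OF famV \<tau>] v v' goodU goodV match] by blast
  interpret U: minimal_clifford_family U B "\<lambda>i. J (axis (e i) 1)" label_sign L by (rule famU)
  interpret V: minimal_clifford_family V C "\<lambda>i. K (axis (swap_sum (e i)) 1)" "\<lambda>i. - label_sign i" L
    by (rule famV)
  define j where "j = the_inv_into (set L) e"
  have j: "j k \<in> set L" "e (j k) = k" for k
    using e(1) f_the_inv_into_f_bij_betw [OF e(1)] the_inv_into_into [of e "set L" k "set L"]
    by (auto simp: j_def bij_betw_def)
  show ?thesis
  proof (rule lie_isomorphicI [OF _ _ A, where c = "\<lambda>k. \<kappa> * \<sigma> (j k) * \<tau> (j k)"])
    show "admissible_module U J B" "admissible_module V K C"
      using minU minV by (simp_all add: minimal_admissible_module_def)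
    show "\<kappa> * \<sigma> (j k) * \<tau> (j k) \<noteq> 0" for k using \<kappa> \<sigma> [of "j k"] \<tau> [of "j k"] by auto
    show "B (J (axis k 1) x) y = \<kappa> * \<sigma> (j k) * \<tau> (j k) * C (K (axis (swap_sum k) 1) (A x)) (A y)"
      if x: "x \<in> U" and y: "y \<in> U" for k x y
    proof -
      have Axy: "A x \<in> V" "A y \<in> V" using A(1) x y by (auto simp: linear_between_def)
      have "\<sigma> (j k) * B (J (axis k 1) x) y = \<kappa> * (\<tau> (j k) * C (K (axis (swap_sum k) 1) (A x)) (A y))"
        using eq [OF j(1) x y, of k] U.gen_closed [OF j(1) x, of k] V.gen_closed [OF j(1) Axy(1), of k] x y Axy
        by (simp add: j(2) U.form_left V.form_left)
      then show ?thesis using \<sigma> [of "j k"] by auto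
    qed
  qed
qed

text \<open>In all four certificates the words \<open>[1,2,3]\<close> and \<open>[1,4,7]\<close>
  exchange roles between the sides: reversing the signs turns a three-letter involution into a
  complex structure and conversely. The four-letter words are involutions on both sides.\<close>

lemma matching_data_5_1:
  "matching_data [1,2,3,4,5,7] [1,2,3] [1,4,7]
    [[1,2,4,5],[1,2,3]] [[1,4,7],[1,5,7]]
    [[1,4,7],[1,2,4,5]] [[1,2,3],[1,3,5]]"
  by code_simp

lemma matching_data_5_2:
  "matching_data [1,2,3,4,5,7,8] [1,2,3] [1,4,7]
    [[1,2,3,4,5,8,7],[1,2,4,5],[1,2,3]] [[1,4,7],[1,4,8]]
    [[1,5,8],[1,4,7],[1,2,4,5]] [[1,2,3]]"
  by code_simp

lemma matching_data_6_1:
  "matching_data [1,2,3,4,5,6,7] [1,2,3] [1,4,7]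
    [[1,3,4,6],[1,2,4,5],[1,2,3]] [[1,4,7]]
    [[1,4,7],[1,3,4,6],[1,2,4,5]] [[1,2,3],[1,2,6]]"
  by code_simp

lemma matching_data_6_2:
  "matching_data [1,2,3,4,5,6,7,8] [1,2,3] [1,4,7]
    [[1,3,4,6],[1,2,4,5],[1,2,3]] [[1,4,7],[1,4,8]]
    [[1,4,7],[1,3,4,6],[1,2,4,5]] [[1,2,3],[1,2,6]]"
  by code_simp

theorem theorem5:
  fixes U :: "'u::real_vector set"
    and J :: "real ^ ('r::finite + 's::finite) \<Rightarrow> 'u \<Rightarrow> 'u"
    and B :: "'u \<Rightarrow> 'u \<Rightarrow> real"
    and V :: "'v::real_vector set"
    and K :: "real ^ ('s + 'r) \<Rightarrow> 'v \<Rightarrow> 'v"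
    and C :: "'v \<Rightarrow> 'v \<Rightarrow> real"
  assumes "(CARD('r), CARD('s)) \<in> {(5, 2), (5, 1), (6, 2), (6, 1)}"
    and "minimal_admissible_module U J B"
    and "minimal_admissible_module V K C"
  shows "lie_isomorphic
    (pseudo_H_carrier U :: ('u \<times> (real ^ ('r + 's))) set) (pseudo_H_bracket J B)
    (pseudo_H_carrier V :: ('v \<times> (real ^ ('s + 'r))) set) (pseudo_H_bracket K C)"
proof -
  note lie_iso = lie_isomorphic_if_matching [OF assms(2,3)]
  from assms(1) consider "CARD('r) = 5" "CARD('s) = 1" | "CARD('r) = 5" "CARD('s) = 2"
    | "CARD('r) = 6" "CARD('s) = 1" | "CARD('r) = 6" "CARD('s) = 2" by auto
  then show ?thesis
  proof cases
    case 1
    then show ?thesis by (intro lie_iso [OF _ _ matching_data_5_1]) simp_all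
  next
    case 2
    then show ?thesis by (intro lie_iso [OF _ _ matching_data_5_2]) simp_all
  next
    case 3
    then show ?thesis by (intro lie_iso [OF _ _ matching_data_6_1]) simp_all
  next
    case 4
    then show ?thesis by (intro lie_iso [OF _ _ matching_data_6_2]) simp_all
  qed
qed

end
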